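(* Let $1\le k<d$ be integers, $\mu\in\mathcal M(\mathbb{R}^d)$, $X\subseteq\mathbb{R}^d$ a Borel set and $\theta\in[0,1]$. Then for all $V\in G(d,k)$, $$\dim_{\mathrm F}^{\theta}\mu_V\ge\dim_{\mathrm F}^{\theta}\mu-(d-k)\theta\qquad\text{and}\qquad\dim_{\mathrm F}^{\theta}P_V(X)\ge\min\{k,\ \dim_{\mathrm F}^{\theta}X-(d-k)\theta\}.$$
   Context: $G(d,k)$ is the Grassmannian of $k$-dimensional linear subspaces $V$ of $\mathbb{R}^d$. $P_V:\mathbb{R}^d\to V$ is orthogonal projection, and $V$ is identified with $\mathbb{R}^k$. $\mu_V$ is the push-forward of $\mu$ under $P_V$, i.e. $\mu_V(B)=\mu(P_V^{-1}(B))$, a measure on $\mathbb{R}^k$. For $X\subseteq\mathbb{R}^d$, $\mathcal M(X)$ is the set of Borel measures $\mu$ compactly supported on $X$ with $0<\mu(X)<\infty$. The Fourier transform is $\widehat\mu(z)=\int e^{-2\pi i z\cdot x}\,d\mu(x)$. For $\mu\in\mathcal M(\mathbb{R}^d)$ and $\theta\in(0,1]$ put $$\mathcal J_{s,\theta}(\mu)=\Big(\int_{\mathbb{R}^d}|\widehat\mu(z)|^{2/\theta}|z|^{s/\theta-d}\,dz\Big)^{\theta},\qquad \mathcal J_{s,0}(\mu)=\sup_{z\in\mathbb{R}^d}|\widehat\mu(z)|^2|z|^s.$$ The Fourier spectrum of $\mu$ at $\theta\in[0,1]$ is $\dim_{\mathrm F}^{\theta}\mu=\sup\{s\in\mathbb{R}:\mathcal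 J_{s,\theta}(\mu)<\infty\}$, and of a set $X\subseteq\mathbb{R}^d$ it is $\dim_{\mathrm F}^{\theta}X=\sup\{\min\{\dim_{\mathrm F}^{\theta}\mu,d\}:\mu\in\mathcal M(X)\}$ (suprema over empty sets are $0$). For $\mu_V$ and $P_V(X)$ these definitions are used in $\mathbb{R}^k$, i.e. with $d$ replaced by $k$. *)

theory Defs
  imports "HOL-Analysis.Analysis"
begin

definition grassmannian :: "nat \<Rightarrow> 'a::euclidean_space set set" where
  "grassmannian k = {V. subspace V \<and> dim V = k}"

definition orth_proj :: "'a::euclidean_space set \<Rightarrow> 'a \<Rightarrow> 'a" where
  "orth_proj V x = (THE y. y \<in> V \<and> (\<forall>v\<in>V. orthogonal (x - y) v))"

(* Linear isometries of V onto the Euclidean space 'b, used to identify V with R^k; only the values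
   of phi on V matter, and a linear isometry defined on V alone extends linearly to 'a. *)
definition identification :: "'a::euclidean_space set \<Rightarrow> ('a \<Rightarrow> 'b::euclidean_space) \<Rightarrow> bool" where
  "identification V \<phi> \<longleftrightarrow> linear \<phi> \<and> (\<forall>x\<in>V. norm (\<phi> x) = norm x) \<and> \<phi> ` V = UNIV"

lemma identification_exists:
  assumes "V \<in> grassmannian DIM('b)"
  shows "\<exists>\<phi> :: 'a::euclidean_space \<Rightarrow> 'b::euclidean_space. identification V \<phi>"
  using isometries_subspaces[of V "UNIV :: 'b set"] assms
  unfolding grassmannian_def identification_def by (metis (mono_tags, lifting) dim_UNIV mem_Collect_eq subspace_UNIV)

definition proj_measure ::
  "'a::euclidean_space set \<Rightarrow> ('a \<Rightarrow> 'b::euclidean_space) \<Rightarrow> 'a measure \<Rightarrow> 'b measure" where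
  "proj_measure V \<phi> \<mu> = distr \<mu> borel (\<lambda>x. \<phi> (orth_proj V x))"

definition proj_set :: "'a::euclidean_space set \<Rightarrow> ('a \<Rightarrow> 'b::euclidean_space) \<Rightarrow> 'a set \<Rightarrow> 'b set" where
  "proj_set V \<phi> X = (\<lambda>x. \<phi> (orth_proj V x)) ` X"

(* X need not be Borel (projections of Borel sets are in general only analytic), so the mass of X
   is taken in the completion of mu, where X is measurable because K is contained in X and has null
   complement. For Borel X it is emeasure mu X. *)
definition cs_measures :: "'a::euclidean_space set \<Rightarrow> 'a measure set" where
  "cs_measures X = {\<mu>. sets \<mu> = sets borel \<and>
     (\<exists>K. compact K \<and> K \<subseteq> X \<and> emeasure \<mu> (- K) = 0) \<and>
     0 < emeasure (completion \<mu>) X \<and> emeasure (completion \<mu>) X < \<infinity>}"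

definition fourier_transform :: "'a::euclidean_space measure \<Rightarrow> 'a \<Rightarrow> complex" where
  "fourier_transform \<mu> z = (\<integral>x. exp (- 2 * complex_of_real pi * \<i> * complex_of_real (z \<bullet> x)) \<partial>\<mu>)"

definition ennreal_powr :: "ennreal \<Rightarrow> real \<Rightarrow> ennreal" where
  "ennreal_powr x a = (if x = \<infinity> then \<infinity> else ennreal (enn2real x powr a))"

(* Since 0 powr s = 0 for every s, the point z = 0 is ignored. For a finite nonzero mu this does not
   change the energy: the integral does not see a point, and in the supremum the factor norm z powr s
   at 0 would be 0 for s > 0, while for s \<le> 0 continuity of the transform at 0 gives the same value. *)
definition fourier_energy :: "real \<Rightarrow> real \<Rightarrow> 'a::euclidean_space measure \<Rightarrow> ennreal" where
  "fourier_energy s \<theta> \<mu> =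
     (if \<theta> = 0 then (SUP z. ennreal ((norm (fourier_transform \<mu> z))\<^sup>2 * norm z powr s))
      else ennreal_powr
        (\<integral>\<^sup>+ z. ennreal (norm (fourier_transform \<mu> z) powr (2 / \<theta>)
                     * norm z powr (s / \<theta> - real DIM('a))) \<partial>lborel) \<theta>)"

(* Suprema are taken in the extended reals (the spectrum of a measure can be infinite), with the
   convention that the supremum of the empty set is 0 rather than -\<infinity>. *)
definition sup0 :: "ereal set \<Rightarrow> ereal" where
  "sup0 A = (if A = {} then 0 else Sup A)"

definition fourier_spectrum :: "real \<Rightarrow> 'a::euclidean_space measure \<Rightarrow> ereal" where
  "fourier_spectrum \<theta> \<mu> = sup0 {ereal s | s. fourier_energy s \<theta> \<mu> < \<infinity>}"

definition fourier_spectrum_set :: "real \<Rightarrow> 'a::euclidean_space set \<Rightarrow> ereal" where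
  "fourier_spectrum_set \<theta> X =
     sup0 {min (fourier_spectrum \<theta> \<mu>) (ereal (real DIM('a))) | \<mu>. \<mu> \<in> cs_measures X}"

end

(*
  The transform of the projected measure is the restriction of the transform F of mu to V, so the claim
  compares the integral of |F|^p |z|^a over V with the one over R^d, where p = 2/theta and a = s/theta - d
  is the same exponent in both integrals. Near 0 the integral over V converges because F is bounded and a > -k.
  For |v| >= 1, compactness of the support lets one write F(v) as an average of F(v + u) over u in the
  orthogonal complement of V against a rapidly decaying kernel; by Jensen |F(v)|^p is at most a constant times
  the average of |F(v + u)|^p, and since u is orthogonal to v the kernel absorbs the ratio of |v|^a and |v + u|^a.
  Integrating over v in V gives back the integral over R^d.
*)
theory Submission
  imports Defs
begin

section \<open>Smoothing kernels\<close>

text \<open>The kernel has to absorb the factor (1 + |u|)^(-a) when a is negative, so its decay is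
  chosen after a: polynomial order n with n >= 2 and n >= -a suffices. It is a product of
  one-dimensional functions in orthonormal coordinates of the complement, which reduces its
  construction to the real line. The comparison of integrals requires a > -k, that is, s > (d - k)
  theta. Below this threshold the claim only asks that the spectrum of the projected measure be
  nonnegative. For theta > 0 this holds because the transform at 0 is the total mass, which is
  positive, so the energy diverges at 0 for every negative s. For theta = 0 no integral occurs: a
  supremum over V is at most the supremum over R^d. A spectrum may be infinite, so the inequalities
  are proved with the loss (d - k) theta added on the right and are rearranged at the end.\<close>

lemma borel_measurable_cis [measurable]: "cis \<in> borel_measurable borel"
  by (intro borel_measurable_continuous_onI continuous_intros)

lemma borel_measurable_linear:
  fixes f :: "'a::euclidean_space \<Rightarrow> 'b::euclidean_space"
  assumes "linear f"
  shows "f \<in> borel_measurable borel"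
  using assms by (intro borel_measurable_continuous_onI) (simp add: linear_continuous_on linear_conv_bounded_linear)

lemma integrable_inverse_one_plus_abs_power:
  assumes "2 \<le> n"
  shows "integrable lborel (\<lambda>y::real. 1 / (1 + \<bar>y\<bar>) ^ n)"
proof -
  define h :: "real \<Rightarrow> real" where "h = (\<lambda>y. 1 / (1 + \<bar>y\<bar>)\<^sup>2 * indicator {0..} y)"
  have hm [measurable]: "h \<in> borel_measurable borel"
    unfolding h_def by measurable
  have "(\<integral>\<^sup>+ y. ennreal (1 / (1 + \<bar>y\<bar>)\<^sup>2) * indicator {0..} y \<partial>lborel) = ennreal (0 - (- 1 / (1 + 0)))"
  proof (rule nn_integral_FTC_atLeast)
    show "((\<lambda>y::real. - 1 / (1 + y)) has_real_derivative 1 / (1 + \<bar>x\<bar>)\<^sup>2) (at x)" if "0 \<le> x" for x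
      using that by (auto intro!: derivative_eq_intros simp: power2_eq_square divide_simps)
    show "((\<lambda>y::real. - 1 / (1 + y)) \<longlongrightarrow> 0) at_top"
      by (intro tendsto_divide_0[OF tendsto_const] filterlim_at_top_imp_at_infinity
          filterlim_tendsto_add_at_top[OF tendsto_const] filterlim_ident)
  qed (auto)
  moreover have "ennreal (norm (h y)) = ennreal (1 / (1 + \<bar>y\<bar>)\<^sup>2) * indicator {0..} y" for y
    by (simp add: h_def indicator_def)
  ultimately have "integrable lborel h"
    by (simp add: integrable_iff_bounded)
  \<comment> \<open>The second summand is the reflection of \<open>h\<close>, written in the affine
    form to which the invariance of \<open>lborel\<close> applies. The point 0 is counted twice,
    which an upper bound tolerates.\<close>
  then have "integrable lborel (\<lambda>y. h y + h (0 + (- 1) * y))"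
    by (intro Bochner_Integration.integrable_add lborel_integrable_real_affine) auto
  then show ?thesis
  proof (rule Bochner_Integration.integrable_bound)
    show "AE y in lborel. norm (1 / (1 + \<bar>y\<bar>) ^ n) \<le> norm (h y + h (0 + (- 1) * y))"
    proof (rule AE_I2)
      fix y :: real
      have "1 / (1 + \<bar>y\<bar>) ^ n \<le> 1 / (1 + \<bar>y\<bar>)\<^sup>2"
        using assms by (intro divide_left_mono power_increasing) (auto intro!: mult_pos_pos)
      moreover have "1 / (1 + \<bar>y\<bar>)\<^sup>2 \<le> h y + h (0 + (- 1) * y)"
        by (auto simp: h_def indicator_def)
      ultimately show "norm (1 / (1 + \<bar>y\<bar>) ^ n) \<le> norm (h y + h (0 + (- 1) * y))"
        by simp
    qed
  qed auto
qed

text \<open>Each regime contributes one summand of the constant. For |y| <= 1, 1 - cos u <= u^2 / 2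
  and (1 + |y|)^2 <= 4 give 2 c^2; for |y| > 1, 1 - cos u <= 2 and (1 + |y|)^2 <= 4 y^2 give 8. At y
  = 0 the quotient is 0 by the convention for division.\<close>

lemma one_minus_cos_over_square_le:
  "\<bar>(1 - cos (c * y)) / y\<^sup>2\<bar> \<le> (2 * c\<^sup>2 + 8) / (1 + \<bar>y\<bar>)\<^sup>2" for c y :: real
proof (cases "y = 0")
  case False
  have nn: "0 \<le> 1 - cos (c * y)" by simp
  have "(1 - cos (c * y)) * (1 + \<bar>y\<bar>)\<^sup>2 \<le> (2 * c\<^sup>2 + 8) * y\<^sup>2"
  proof (cases "\<bar>y\<bar> \<le> 1")
    case True
    have "cos (c * y) = 1 - 2 * (sin (c * y / 2))\<^sup>2"
      using cos_double_sin[of "c * y / 2"] by simp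
    moreover have "(sin (c * y / 2))\<^sup>2 \<le> (c * y / 2)\<^sup>2"
      using abs_sin_x_le_abs_x[of "c * y / 2"] by (rule abs_le_square_iff[THEN iffD1])
    ultimately have "1 - cos (c * y) \<le> c\<^sup>2 * y\<^sup>2 / 2"
      by (simp add: power_mult_distrib power_divide)
    moreover have "(1 + \<bar>y\<bar>)\<^sup>2 \<le> 2\<^sup>2"
      using True by (intro power_mono) auto
    ultimately have "(1 - cos (c * y)) * (1 + \<bar>y\<bar>)\<^sup>2 \<le> c\<^sup>2 * y\<^sup>2 / 2 * 4"
      using nn by (intro mult_mono) auto
    then show ?thesis by (simp add: distrib_right add_increasing2)
  next
    case False
    then have "(1 + \<bar>y\<bar>)\<^sup>2 \<le> (2 * \<bar>y\<bar>)\<^sup>2"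
      by (intro power_mono) auto
    moreover have "1 - cos (c * y) \<le> 2"
      using cos_ge_minus_one[of "c * y"] by linarith
    ultimately have "(1 - cos (c * y)) * (1 + \<bar>y\<bar>)\<^sup>2 \<le> 2 * (2 * \<bar>y\<bar>)\<^sup>2"
      using nn by (intro mult_mono) auto
    also have "\<dots> \<le> (2 * c\<^sup>2 + 8) * y\<^sup>2"
      by (simp add: power_mult_distrib algebra_simps)
    finally show ?thesis .
  qed
  then show ?thesis
    using False nn by (simp add: abs_divide divide_le_eq pos_le_divide_eq)
qed simp

lemma integrable_one_minus_cos_over_square:
  "integrable lborel (\<lambda>y::real. (1 - cos (c * y)) / y\<^sup>2)"
proof (rule Bochner_Integration.integrable_bound)
  show "integrable lborel (\<lambda>y::real. (2 * c\<^sup>2 + 8) * (1 / (1 + \<bar>y\<bar>)\<^sup>2))"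
    by (intro integrable_mult_right integrable_inverse_one_plus_abs_power) simp
  show "AE y in lborel. norm ((1 - cos (c * y)) / y\<^sup>2) \<le> norm ((2 * c\<^sup>2 + 8) * (1 / (1 + \<bar>y\<bar>)\<^sup>2))"
    using one_minus_cos_over_square_le[of c] by (intro AE_I2) (simp add: abs_mult)
qed auto

lemma integral_one_minus_cos_over_square:
  fixes c :: real
  assumes "0 \<le> c"
  shows "(\<integral>y. (1 - cos (c * y)) / y\<^sup>2 \<partial>lborel) = c * (\<integral>y. (1 - cos y) / y\<^sup>2 \<partial>lborel)"
proof (cases "c = 0")
  case False
  have "(\<integral>y. (1 - cos (c * y)) / y\<^sup>2 \<partial>lborel)
      = \<bar>1 / c\<bar> *\<^sub>R (\<integral>y. (1 - cos (c * (0 + 1 / c * y))) / (0 + 1 / c * y)\<^sup>2 \<partial>lborel)"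
    using False by (intro lborel_integral_real_affine) simp
  also have "\<dots> = (1 / c) * (\<integral>y. c\<^sup>2 * ((1 - cos y) / y\<^sup>2) \<partial>lborel)"
    using False assms by (simp add: power_divide mult.commute)
  also have "\<dots> = c * (\<integral>y. (1 - cos y) / y\<^sup>2 \<partial>lborel)"
    using False by (subst integral_mult_right_zero) (simp add: power2_eq_square)
  finally show ?thesis .
qed simp

text \<open>This allows dividing by the integral in \<open>trapezoid_kernel\<close>. On [1, 2],
  inside the range where cos decreases, the integrand is at least (1 - cos 1) / 4.\<close>

lemma integral_one_minus_cos_over_square_pos:
  "0 < (\<integral>y. (1 - cos y) / (y::real)\<^sup>2 \<partial>lborel)"
proof -
  have c1: "0 < 1 - cos (1::real)"
    using cos_monotone_0_pi[of 0 1] pi_gt3 by simp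
  have "(\<integral>y. (1 - cos 1) / 4 * indicator {1..2} (y::real) \<partial>lborel) \<le> (\<integral>y. (1 - cos y) / (y::real)\<^sup>2 \<partial>lborel)"
  proof (rule integral_mono)
    show "integrable lborel (\<lambda>y::real. (1 - cos y) / y\<^sup>2)"
      using integrable_one_minus_cos_over_square[of 1] by simp
    fix y :: real
    have "(1 - cos 1) / 4 \<le> (1 - cos y) / y\<^sup>2" if "1 \<le> y" "y \<le> 2"
    proof (rule frac_le)
      show "1 - cos 1 \<le> 1 - cos y"
        using that pi_gt3 cos_monotone_0_pi_le[of 1 y] by simp
      show "y\<^sup>2 \<le> 4"
        using that power_mono[of y 2 2] by simp
    qed (use that in auto)
    then show "(1 - cos 1) / 4 * indicator {1..2} y \<le> (1 - cos y) / y\<^sup>2"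
      by (auto simp: indicator_def)
  qed auto
  moreover have "(\<integral>y. (1 - cos (1::real)) / 4 * indicator {1..2} (y::real) \<partial>lborel) = (1 - cos 1) / 4"
    by simp
  moreover have "0 < (1 - cos (1::real)) / 4"
    using c1 by simp
  ultimately show ?thesis
    by (metis order_less_le_trans)
qed

lemma integrable_mult_cis:
  fixes g :: "real \<Rightarrow> complex"
  assumes [measurable]: "g \<in> borel_measurable borel"
    and "\<And>y. norm (g y) \<le> C / (1 + \<bar>y\<bar>) ^ n" "2 \<le> n"
  shows "integrable lborel (\<lambda>y. g y * cis (x * y))"
proof (rule Bochner_Integration.integrable_bound)
  show "integrable lborel (\<lambda>y::real. C * (1 / (1 + \<bar>y\<bar>) ^ n))"
    using assms by (intro integrable_mult_right integrable_inverse_one_plus_abs_power)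
  have "norm (g y) \<le> \<bar>C / (1 + \<bar>y\<bar>) ^ n\<bar>" for y
    using assms(2)[of y] by linarith
  then show "AE y in lborel. norm (g y * cis (x * y)) \<le> norm (C * (1 / (1 + \<bar>y\<bar>) ^ n))"
    by (intro AE_I2) (simp add: norm_mult)
  show "(\<lambda>y. g y * cis (x * y)) \<in> borel_measurable lborel"
    by measurable
qed

text \<open>The transform of the kernel is a trapezoid: by scaling, the integral of \<open>(1 - cos (c y)) / y\<^sup>2\<close> is
  proportional to \<open>\<bar>c\<bar>\<close>, so its actual value is not needed.\<close>

lemma trapezoid_kernel:
  fixes R :: real
  assumes "0 < R"
  obtains g :: "real \<Rightarrow> complex" and C :: real
  where "g \<in> borel_measurable borel" "\<And>y. norm (g y) \<le> C / (1 + \<bar>y\<bar>)\<^sup>2"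
    "\<And>x. \<bar>x\<bar> \<le> R \<Longrightarrow> (\<integral>y. g y * cis (x * y) \<partial>lborel) = 1"
proof -
  define q where "q = (\<integral>y. (1 - cos y) / (y::real)\<^sup>2 \<partial>lborel)"
  have q: "0 < q"
    using integral_one_minus_cos_over_square_pos by (simp add: q_def)
  \<comment> \<open>The cosine transform of \<open>r\<close> at x is half of |R+1+x| + |R+1-x| -
    |R+x| - |R-x|: a trapezoid equal to 1 on [-R, R] and 0 outside [-R-1, R+1].\<close>
  define r where "r = (\<lambda>y::real. (cos (R * y) - cos ((R + 1) * y)) / y\<^sup>2 / q)"
  define C where "C = ((2 * (R + 1)\<^sup>2 + 8) + (2 * R\<^sup>2 + 8)) / q"
  have rm [measurable]: "r \<in> borel_measurable borel"
    unfolding r_def by measurable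
  have bound: "norm (complex_of_real (r y)) \<le> C / (1 + \<bar>y\<bar>)\<^sup>2" for y
  proof -
    have "r y = ((1 - cos ((R + 1) * y)) / y\<^sup>2 - (1 - cos (R * y)) / y\<^sup>2) / q"
      by (simp add: r_def diff_divide_distrib)
    also have "\<bar>\<dots>\<bar> = \<bar>(1 - cos ((R + 1) * y)) / y\<^sup>2 - (1 - cos (R * y)) / y\<^sup>2\<bar> / q"
      using q by (simp add: abs_divide)
    also have "\<dots> \<le> ((2 * (R + 1)\<^sup>2 + 8) / (1 + \<bar>y\<bar>)\<^sup>2 + (2 * R\<^sup>2 + 8) / (1 + \<bar>y\<bar>)\<^sup>2) / q"
      using q one_minus_cos_over_square_le[of "R + 1" y] one_minus_cos_over_square_le[of R y]
      by (intro divide_right_mono) linarith+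
    also have "\<dots> = C / (1 + \<bar>y\<bar>)\<^sup>2"
      by (simp add: C_def add_divide_distrib mult.commute)
    finally show ?thesis by simp
  qed
  have "(\<integral>y. complex_of_real (r y) * cis (x * y) \<partial>lborel) = 1" if x: "\<bar>x\<bar> \<le> R" for x
  proof -
    let ?I = "\<lambda>x. \<integral>y. complex_of_real (r y) * cis (x * y) \<partial>lborel"
    have int: "integrable lborel (\<lambda>y. complex_of_real (r y) * cis (x * y))" for x
      by (rule integrable_mult_cis[where n = 2, OF _ bound]) auto
    \<comment> \<open>Since \<open>r\<close> is even, the substitution of -y for y shows that
      \<open>?I\<close> is even. Averaging \<open>?I x\<close> and \<open>?I (- x)\<close> leaves a
      real cosine integral.\<close>
    have "?I x = \<bar>-1\<bar> *\<^sub>R (\<integral>y. complex_of_real (r (0 + (-1) * y)) * cis (x * (0 + (-1) * y)) \<partial>lborel)"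
      by (rule lborel_integral_real_affine) simp
    then have "?I x = ?I (- x)"
      by (simp add: r_def)
    then have "?I x = (?I x + ?I (- x)) / 2"
      by simp
    also have "\<dots> = (\<integral>y. (complex_of_real (r y) * cis (x * y) + complex_of_real (r y) * cis (- x * y)) / 2 \<partial>lborel)"
      using int[of x] int[of "- x"] by simp
    also have "\<dots> = (\<integral>y. complex_of_real (r y * cos (x * y)) \<partial>lborel)"
      by (intro Bochner_Integration.integral_cong) (auto simp: complex_eq_iff)
    also have "\<dots> = complex_of_real (\<integral>y. r y * cos (x * y) \<partial>lborel)"
      by (rule integral_complex_of_real)
    also have "(\<integral>y. r y * cos (x * y) \<partial>lborel)
        = (\<integral>y. ((1 - cos ((R + 1 + x) * y)) / y\<^sup>2 + (1 - cos ((R + 1 - x) * y)) / y\<^sup>2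
             - (1 - cos ((R + x) * y)) / y\<^sup>2 - (1 - cos ((R - x) * y)) / y\<^sup>2) / (2 * q) \<partial>lborel)"
    proof (intro Bochner_Integration.integral_cong refl)
      fix y :: real
      have "cos (R * y) * cos (x * y) = (cos ((R - x) * y) + cos ((R + x) * y)) / 2"
        "cos ((R + 1) * y) * cos (x * y) = (cos ((R + 1 - x) * y) + cos ((R + 1 + x) * y)) / 2"
        by (simp_all add: cos_times_cos flip: left_diff_distrib distrib_right)
      then have "(cos (R * y) - cos ((R + 1) * y)) * cos (x * y) =
        ((1 - cos ((R + 1 + x) * y)) + (1 - cos ((R + 1 - x) * y)) - (1 - cos ((R + x) * y)) - (1 - cos ((R - x) * y))) / 2"
        unfolding left_diff_distrib by (simp add: field_simps)
      then have "r y * cos (x * y) =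
        ((1 - cos ((R + 1 + x) * y)) + (1 - cos ((R + 1 - x) * y)) - (1 - cos ((R + x) * y)) - (1 - cos ((R - x) * y))) / 2 / y\<^sup>2 / q"
        unfolding r_def by (metis times_divide_eq_left)
      then show "r y * cos (x * y) = ((1 - cos ((R + 1 + x) * y)) / y\<^sup>2 + (1 - cos ((R + 1 - x) * y)) / y\<^sup>2
             - (1 - cos ((R + x) * y)) / y\<^sup>2 - (1 - cos ((R - x) * y)) / y\<^sup>2) / (2 * q)"
        by (simp add: add_divide_distrib diff_divide_distrib mult.commute)
    qed
    \<comment> \<open>The bound |x| <= R makes all four frequencies nonnegative, as the scaling
      formula demands.\<close>
    also have "\<dots> = ((R + 1 + x) * q + (R + 1 - x) * q - (R + x) * q - (R - x) * q) / (2 * q)"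
      using x by (simp add: integrable_one_minus_cos_over_square integral_one_minus_cos_over_square q_def)
    also have "\<dots> = 1"
      using q by (simp add: field_simps)
    finally show ?thesis by simp
  qed
  with bound show ?thesis
    by (intro that[of "\<lambda>y. complex_of_real (r y)" C]) auto
qed

text \<open>The closed form exhibits the decay of order 1/|y| by which
  \<open>smoothing_kernel\<close> gains one power.\<close>

lemma integral_cis_Icc:
  assumes "y \<noteq> 0"
  shows "(\<integral>t. indicator {-1..1} t *\<^sub>R cis (t * y) \<partial>lborel) = (cis y - cis (- y)) / (\<i> * y)"
proof -
  have "(\<integral>t. indicator {-1..1} t *\<^sub>R cis (t * y) \<partial>lborel) = cis (1 * y) / (\<i> * y) - cis (-1 * y) / (\<i> * y)"
  proof (rule integral_FTC_atLeastAtMost)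
    show "((\<lambda>t. cis (t * y) / (\<i> * y)) has_vector_derivative cis (x * y)) (at x within {-1..1})" for x
    proof -
      have "((\<lambda>z. exp (z * c) / c) has_field_derivative exp (of_real x * c)) (at (of_real x))"
        if "c \<noteq> 0" for c :: complex
        using that by (auto intro!: derivative_eq_intros)
      from has_vector_derivative_real_field[OF this[of "\<i> * y"]] assms show ?thesis
        by (simp add: cis_conv_exp mult_ac)
    qed
    show "continuous_on {-1..1} (\<lambda>t. cis (t * y))"
      by (intro continuous_intros)
  qed simp
  then show ?thesis by (simp add: diff_divide_distrib)
qed

text \<open>Multiplying \<open>g\<close> by \<open>sin y / y\<close> improves the decay by one power and averages its transform over
  intervals of radius 1, which only shrinks the range on which the transform is 1.\<close>

lemma smoothing_kernel:
  fixes R :: real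
  assumes "2 \<le> n" "0 < R"
  shows "\<exists>(g :: real \<Rightarrow> complex) C. g \<in> borel_measurable borel \<and> (\<forall>y. norm (g y) \<le> C / (1 + \<bar>y\<bar>) ^ n)
    \<and> (\<forall>x. \<bar>x\<bar> \<le> R \<longrightarrow> (\<integral>y. g y * cis (x * y) \<partial>lborel) = 1)"
  using assms
proof (induction n arbitrary: R rule: dec_induct)
  case base
  then show ?case by (metis trapezoid_kernel)
next
  case (step n)
  \<comment> \<open>Averaging over shifts t in [-1, 1] evaluates the old transform at t + x, so it
    has to be 1 up to R + 1.\<close>
  from step.IH[of "R + 1"] step.prems obtain g :: "real \<Rightarrow> complex" and C where
    gm [measurable]: "g \<in> borel_measurable borel" and gb: "\<And>y. norm (g y) \<le> C / (1 + \<bar>y\<bar>) ^ n"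
    and gi: "\<And>x. \<bar>x\<bar> \<le> R + 1 \<Longrightarrow> (\<integral>y. g y * cis (x * y) \<partial>lborel) = 1"
    by fastforce
  \<comment> \<open>This is sin y / y, kept as an average of characters: the form gives the bound 1,
    the correct value at 0 and the double integral to which Fubini is applied.\<close>
  define S where "S = (\<lambda>y::real. (\<integral>t. indicator {-1..1} t *\<^sub>R cis (t * y) \<partial>lborel) / 2)"
  have Sm [measurable]: "S \<in> borel_measurable borel"
    unfolding S_def by measurable
  have S1: "norm (S y) \<le> 1" for y
  proof -
    have "norm (\<integral>t. indicator {-1..1} t *\<^sub>R cis (t * y) \<partial>lborel)
        \<le> (\<integral>t. norm (indicator {-1..1} t *\<^sub>R cis (t * y)) \<partial>lborel)"
      by (rule integral_norm_bound)
    then show ?thesis by (simp add: S_def norm_divide)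
  qed
  have S2: "norm (S y) \<le> 2 / (1 + \<bar>y\<bar>)" for y
  proof (cases "\<bar>y\<bar> \<le> 1")
    case True
    then have "1 \<le> 2 / (1 + \<bar>y\<bar>)" by (simp add: field_simps)
    with S1[of y] show ?thesis by linarith
  next
    case False
    then have "y \<noteq> 0" by auto
    then have "norm (S y) = norm (cis y - cis (- y)) / \<bar>y\<bar> / 2"
      by (simp add: S_def integral_cis_Icc norm_divide norm_mult)
    also have "\<dots> \<le> 2 / \<bar>y\<bar> / 2"
      using norm_triangle_ineq4[of "cis y" "cis (- y)"] by (intro divide_right_mono) auto
    also have "\<dots> \<le> 2 / (1 + \<bar>y\<bar>)"
      using False by (simp add: field_simps)
    finally show ?thesis .
  qed
  have "norm (g y * S y) \<le> (2 * C) / (1 + \<bar>y\<bar>) ^ Suc n" for y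
  proof -
    have "norm (g y) * norm (S y) \<le> C / (1 + \<bar>y\<bar>) ^ n * (2 / (1 + \<bar>y\<bar>))"
      using order_trans[OF norm_ge_zero gb[of y]] by (intro mult_mono gb S2) auto
    then show ?thesis by (simp add: norm_mult mult.commute)
  qed
  moreover have "(\<integral>y. g y * S y * cis (x * y) \<partial>lborel) = 1" if x: "\<bar>x\<bar> \<le> R" for x
  proof -
    let ?f = "\<lambda>t y. indicator {-1..1} t *\<^sub>R (g y * cis ((t + x) * y))"
    have gint: "integrable lborel (\<lambda>y. g y * cis (x * y))" for x
      using step.hyps by (intro integrable_mult_cis[OF gm gb]) auto
    have "integrable (lborel \<Otimes>\<^sub>M lborel) (case_prod ?f)"
    proof (rule lborel_pair.Fubini_integrable)
      have "integrable lborel (\<lambda>t::real. indicator {-1..1} t * (\<integral>y. norm (g y) \<partial>lborel))"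
        by auto
      then show "integrable lborel (\<lambda>t. \<integral>y. norm (case_prod ?f (t, y)) \<partial>lborel)"
        by (simp add: norm_mult)
      show "AE t in lborel. integrable lborel (\<lambda>y. case_prod ?f (t, y))"
        using gint by simp
    qed measurable
    then have "(\<integral>y. (\<integral>t. ?f t y \<partial>lborel) \<partial>lborel) = (\<integral>t. (\<integral>y. ?f t y \<partial>lborel) \<partial>lborel)"
      by (rule lborel_pair.Fubini_integral)
    also have "\<dots> = (\<integral>t. indicator {-1..1} (t::real) *\<^sub>R 1 \<partial>lborel)"
    proof (intro Bochner_Integration.integral_cong refl)
      fix t :: real
      show "(\<integral>y. ?f t y \<partial>lborel) = indicator {-1..1} t *\<^sub>R 1"
        using x gi[of "t + x"] by (cases "t \<in> {-1..1}") auto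
    qed
    also have "\<dots> = 2" by (simp add: scaleR_conv_of_real)
    finally have "(\<integral>y. (\<integral>t. ?f t y \<partial>lborel) \<partial>lborel) = 2" .
    moreover have "(\<integral>t. ?f t y \<partial>lborel) = 2 * (g y * S y * cis (x * y))" for y
    proof -
      have "(\<integral>t. ?f t y \<partial>lborel) = (\<integral>t. (g y * cis (x * y)) * (indicator {-1..1} t *\<^sub>R cis (t * y)) \<partial>lborel)"
        by (intro Bochner_Integration.integral_cong refl)
          (simp add: distrib_right flip: cis_mult)
      also have "\<dots> = (g y * cis (x * y)) * (\<integral>t. indicator {-1..1} t *\<^sub>R cis (t * y) \<partial>lborel)"
        by (rule integral_mult_right_zero)
      finally show ?thesis by (simp add: S_def)
    qed
    ultimately show ?thesis
      by simp
  qed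
  ultimately show ?case
    by (intro exI[of _ "\<lambda>y. g y * S y"] exI[of _ "2 * C"]) auto
qed

section \<open>Lebesgue measure in orthonormal coordinates\<close>

lemma nn_integral_lborel_translation:
  fixes f :: "'a::euclidean_space \<Rightarrow> ennreal"
  assumes [measurable]: "f \<in> borel_measurable borel"
  shows "(\<integral>\<^sup>+ x. f (x + c) \<partial>lborel) = (\<integral>\<^sup>+ x. f x \<partial>lborel)"
proof -
  have "(\<integral>\<^sup>+ x. f x \<partial>lborel) = (\<integral>\<^sup>+ x. f x \<partial>distr lborel borel ((+) c))"
    by (simp add: lborel_distr_plus)
  also have "\<dots> = (\<integral>\<^sup>+ x. f (x + c) \<partial>lborel)"
    by (subst nn_integral_distr) (auto simp: add.commute)
  finally show ?thesis ..
qed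

text \<open>The Fubini argument for uniqueness of Haar measure: both sides agree after multiplication
  with the volume of a ball, which is invariant under \<open>U\<close>.\<close>

lemma nn_integral_lborel_orthogonal_transformation:
  fixes f :: "'a::euclidean_space \<Rightarrow> ennreal" and U :: "'a \<Rightarrow> 'a"
  assumes U: "orthogonal_transformation U" and [measurable]: "f \<in> borel_measurable borel"
  shows "(\<integral>\<^sup>+ x. f (U x) \<partial>lborel) = (\<integral>\<^sup>+ x. f x \<partial>lborel)"
proof -
  have lin: "linear U" using U by (simp add: orthogonal_transformation_def)
  then have Um [measurable]: "U \<in> borel_measurable borel"
    by (rule borel_measurable_linear)
  define B :: "'a set" where "B = ball 0 1"
  have Bm [measurable]: "B \<in> sets borel" by (simp add: B_def)
  have symm: "indicator B (- U x) = (indicator B x :: ennreal)" for x :: 'a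
    using U by (simp add: B_def indicator_def orthogonal_transformation_norm)
  have b: "(\<integral>\<^sup>+ y. indicator B (y - c) \<partial>lborel) = emeasure lborel B" for c
    using nn_integral_lborel_translation[of "indicator B" "- c"] by simp
  have "(\<integral>\<^sup>+ x. f (U x) \<partial>lborel) * emeasure lborel B
      = (\<integral>\<^sup>+ x. (\<integral>\<^sup>+ y. f (U x) * indicator B (y - U x) \<partial>lborel) \<partial>lborel)"
    by (simp add: nn_integral_cmult nn_integral_multc b)
  also have "\<dots> = (\<integral>\<^sup>+ y. (\<integral>\<^sup>+ x. f (U x) * indicator B (y - U x) \<partial>lborel) \<partial>lborel)"
    by (rule lborel_pair.Fubini'[symmetric]) measurable
  also have "\<dots> = (\<integral>\<^sup>+ y. (\<integral>\<^sup>+ x. f (U x + y) * indicator B (- U x) \<partial>lborel) \<partial>lborel)"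
  proof (rule nn_integral_cong)
    fix y :: 'a
    \<comment> \<open>Writing y as \<open>U z\<close> turns a shift of x by z into a shift of
      \<open>U x\<close> by y. This moves y from the indicator into \<open>f\<close>, where
      translation invariance in y can remove \<open>U x\<close>.\<close>
    obtain z where z: "y = U z"
      using orthogonal_transformation_surj[OF U] by (metis surjD)
    have "(\<integral>\<^sup>+ x. f (U x) * indicator B (y - U x) \<partial>lborel)
        = (\<integral>\<^sup>+ x. f (U (x + z)) * indicator B (y - U (x + z)) \<partial>lborel)"
      by (rule nn_integral_lborel_translation[symmetric]) measurable
    then show "(\<integral>\<^sup>+ x. f (U x) * indicator B (y - U x) \<partial>lborel)
        = (\<integral>\<^sup>+ x. f (U x + y) * indicator B (- U x) \<partial>lborel)"
      by (simp add: z linear_add[OF lin])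
  qed
  also have "\<dots> = (\<integral>\<^sup>+ x. (\<integral>\<^sup>+ y. f (U x + y) * indicator B (- U x) \<partial>lborel) \<partial>lborel)"
    by (rule lborel_pair.Fubini') measurable
  also have "\<dots> = (\<integral>\<^sup>+ x. (\<integral>\<^sup>+ y. f (y + U x) \<partial>lborel) * indicator B x \<partial>lborel)"
    by (simp add: nn_integral_multc symm add.commute)
  also have "\<dots> = (\<integral>\<^sup>+ x. f x \<partial>lborel) * emeasure lborel B"
    by (simp add: nn_integral_lborel_translation nn_integral_cmult)
  finally have "(\<integral>\<^sup>+ x. f (U x) \<partial>lborel) * emeasure lborel B = (\<integral>\<^sup>+ x. f x \<partial>lborel) * emeasure lborel B" .
  moreover have "emeasure lborel B < \<infinity>" "emeasure lborel B \<noteq> 0"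
    by (simp_all add: B_def emeasure_lborel_ball_finite emeasure_ball unit_ball_vol_pos ennreal_eq_0_iff not_le)
  ultimately show ?thesis
    by (metis ennreal_mult_divide_eq infinity_ennreal_def less_irrefl)
qed

text \<open>The map only relabels standard coordinates: \<open>\<beta>\<close> places those of the
  smaller space, and \<open>J\<close> indexes the others. The preimage of a box is therefore a box
  times a product of intervals, and the volumes of boxes determine \<open>lborel\<close>.\<close>

lemma lborel_split_coordinates:
  fixes \<beta> :: "'b::euclidean_space \<Rightarrow> 'a::euclidean_space"
  assumes inj: "inj_on \<beta> Basis" and sub: "\<beta> ` Basis \<subseteq> Basis"
  defines "J \<equiv> Basis - \<beta> ` Basis"
  shows "distr (lborel \<Otimes>\<^sub>M (\<Pi>\<^sub>M i\<in>J. lborel)) borel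
           (\<lambda>(w, t). (\<Sum>b\<in>Basis. (w \<bullet> b) *\<^sub>R \<beta> b) + (\<Sum>i\<in>J. t i *\<^sub>R i)) = lborel"
    (is "distr ?P borel ?T = _")
proof (rule sym, rule lborel_eqI)
  interpret product_sigma_finite "\<lambda>_::'a. lborel :: real measure" ..
  have fJ: "finite J" by (simp add: J_def)
  interpret PJ: sigma_finite_measure "\<Pi>\<^sub>M i\<in>J. (lborel :: real measure)"
    by (rule sigma_finite[OF fJ])
  have Tm [measurable]: "?T \<in> ?P \<rightarrow>\<^sub>M borel"
    unfolding split_beta' by measurable
  have inner1: "?T (w, t) \<bullet> \<beta> b = w \<bullet> b" if "b \<in> Basis" for w t b
  proof -
    have "(\<Sum>c\<in>Basis. (w \<bullet> c) * (\<beta> c \<bullet> \<beta> b)) = (\<Sum>c\<in>Basis. if c = b then w \<bullet> c else 0)"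
      using inj sub that by (intro sum.cong) (auto simp: inner_Basis inj_on_eq_iff image_subset_iff)
    moreover have "(\<Sum>i\<in>J. t i * (i \<bullet> \<beta> b)) = 0"
      using sub that by (intro sum.neutral) (auto simp: J_def inner_Basis image_subset_iff)
    ultimately show ?thesis
      using that by (simp add: inner_add_left inner_sum_left)
  qed
  have inner2: "?T (w, t) \<bullet> i = t i" if "i \<in> J" for w t i
  proof -
    have "(\<Sum>c\<in>J. t c * (c \<bullet> i)) = (\<Sum>c\<in>J. if c = i then t c else 0)"
      using that by (intro sum.cong) (auto simp: inner_Basis J_def)
    moreover have "(\<Sum>c\<in>Basis. (w \<bullet> c) * (\<beta> c \<bullet> i)) = 0"
      using sub that by (intro sum.neutral) (auto simp: J_def inner_Basis image_subset_iff)
    ultimately show ?thesis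
      using that fJ by (simp add: inner_add_left inner_sum_left)
  qed
  fix l u :: 'a
  assume lu: "\<And>b. b \<in> Basis \<Longrightarrow> l \<bullet> b \<le> u \<bullet> b"
  have Basis_eq: "(Basis :: 'a set) = \<beta> ` Basis \<union> J"
    using sub by (auto simp: J_def)
  define l' u' :: 'b where "l' = (\<Sum>b\<in>Basis. (l \<bullet> \<beta> b) *\<^sub>R b)" and "u' = (\<Sum>b\<in>Basis. (u \<bullet> \<beta> b) *\<^sub>R b)"
  have l'u': "l' \<bullet> b = l \<bullet> \<beta> b" "u' \<bullet> b = u \<bullet> \<beta> b" if "b \<in> Basis" for b
    using that by (simp_all add: l'_def u'_def)
  have "?T -` box l u \<inter> space ?P = box l' u' \<times> (\<Pi>\<^sub>E i\<in>J. {l \<bullet> i <..< u \<bullet> i})"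
  proof (intro set_eqI)
    fix p :: "'b \<times> ('a \<Rightarrow> real)"
    obtain w t where p: "p = (w, t)" by fastforce
    have "?T (w, t) \<in> box l u \<longleftrightarrow> w \<in> box l' u' \<and> (\<forall>i\<in>J. t i \<in> {l \<bullet> i <..< u \<bullet> i})"
      unfolding mem_box Basis_eq ball_Un ball_simps
      by (simp add: inner1[simplified] inner2[simplified] l'u' cong: ball_cong)
    then show "p \<in> ?T -` box l u \<inter> space ?P \<longleftrightarrow> p \<in> box l' u' \<times> (\<Pi>\<^sub>E i\<in>J. {l \<bullet> i <..< u \<bullet> i})"
      unfolding p by (auto simp: space_pair_measure space_PiM PiE_iff)
  qed
  then have "emeasure (distr ?P borel ?T) (box l u) = emeasure ?P (box l' u' \<times> (\<Pi>\<^sub>E i\<in>J. {l \<bullet> i <..< u \<bullet> i}))"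
    by (subst emeasure_distr[OF Tm]) auto
  also have "\<dots> = emeasure lborel (box l' u') * emeasure (\<Pi>\<^sub>M i\<in>J. lborel) (\<Pi>\<^sub>E i\<in>J. {l \<bullet> i <..< u \<bullet> i})"
    using fJ by (intro PJ.emeasure_pair_measure_Times) auto
  also have "emeasure (\<Pi>\<^sub>M i\<in>J. lborel) (\<Pi>\<^sub>E i\<in>J. {l \<bullet> i <..< u \<bullet> i}) = ennreal (\<Prod>i\<in>J. (u - l) \<bullet> i)"
    using fJ lu by (subst emeasure_PiM) (auto simp: J_def inner_diff_left intro!: prod_ennreal)
  also have "emeasure lborel (box l' u') = ennreal (\<Prod>b\<in>Basis. (u - l) \<bullet> \<beta> b)"
    using lu sub by (subst emeasure_lborel_box) (auto simp: l'u' inner_diff_left image_subset_iff)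
  also have "\<dots> = ennreal (\<Prod>b\<in>\<beta> ` Basis. (u - l) \<bullet> b)"
    using inj by (simp add: prod.reindex)
  also have "\<dots> * ennreal (\<Prod>i\<in>J. (u - l) \<bullet> i) = ennreal (\<Prod>b\<in>Basis. (u - l) \<bullet> b)"
    using lu sub by (subst prod.subset_diff[OF sub])
      (auto simp: J_def inner_diff_left intro!: ennreal_mult'[symmetric] prod_nonneg simp: mult.commute)
  finally show "emeasure (distr ?P borel ?T) (box l u) = ennreal (\<Prod>b\<in>Basis. (u - l) \<bullet> b)" .
qed simp

text \<open>Fubini along the range of \<open>\<psi>\<close> and its orthogonal complement. The
  relabelling of \<open>lborel_split_coordinates\<close> is followed by an orthogonal map that
  carries coordinate subspaces to these two, so that only rotation invariance is added.\<close>

lemma isometry_coordinates: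
  fixes \<psi> :: "'b::euclidean_space \<Rightarrow> 'a::euclidean_space"
  assumes lin: "linear \<psi>" and iso: "\<And>w. norm (\<psi> w) = norm w"
  obtains J :: "'a set" and u :: "'a \<Rightarrow> 'a" where "finite J"
    "\<And>i. i \<in> J \<Longrightarrow> norm (u i) = 1" "\<And>w i. i \<in> J \<Longrightarrow> \<psi> w \<bullet> u i = 0"
    "\<And>h. h \<in> borel_measurable borel \<Longrightarrow> (\<integral>\<^sup>+ z. h z \<partial>lborel)
       = (\<integral>\<^sup>+ w. (\<integral>\<^sup>+ t. h (\<psi> w + (\<Sum>i\<in>J. t i *\<^sub>R u i)) \<partial>(\<Pi>\<^sub>M i\<in>J. lborel)) \<partial>lborel)"
proof -
  have inj: "inj \<psi>"
    using lin iso by (metis linear_injective_0 norm_eq_zero)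
  have dim_range: "dim (range \<psi>) = DIM('b)"
    using lin inj by (simp add: dim_image_eq)
  then have "DIM('b) \<le> DIM('a)"
    by (metis dim_subset_UNIV)
  then obtain \<beta> :: "'b \<Rightarrow> 'a" where \<beta>: "\<beta> ` Basis \<subseteq> Basis" "inj_on \<beta> Basis"
    using card_le_inj[of "Basis :: 'b set" "Basis :: 'a set"] by auto
  define J :: "'a set" where "J = Basis - \<beta> ` Basis"
  have fJ: "finite J" by (simp add: J_def)
  have Basis_eq: "(Basis :: 'a set) = \<beta> ` Basis \<union> J"
    using \<beta> by (auto simp: J_def)
  have \<beta>\<beta>: "\<beta> b \<bullet> \<beta> c = (if b = c then 1 else 0)" if "b \<in> Basis" "c \<in> Basis" for b c
    using \<beta> that by (auto simp: inner_Basis inj_on_eq_iff image_subset_iff)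
  have \<beta>J: "\<beta> b \<bullet> i = 0" "i \<bullet> \<beta> b = 0" if "b \<in> Basis" "i \<in> J" for b i
    using \<beta> that by (auto simp: inner_Basis J_def image_subset_iff)
  have JJ: "i \<bullet> j = (if i = j then 1 else 0)" if "i \<in> J" "j \<in> J" for i j
    using that by (simp add: inner_Basis J_def)
  \<comment> \<open>\<open>W\<close> is the orthogonal complement of the range of
    \<open>\<psi>\<close>. It has the same dimension as \<open>span J\<close>, which provides the
    isometry \<open>f\<close> between the two.\<close>
  define W where "W = {y \<in> UNIV. \<forall>x\<in>range \<psi>. orthogonal x y}"
  have subW: "subspace W"
    unfolding W_def by (auto simp: subspace_def orthogonal_clauses)
  have "subspace (range \<psi>)"
    using lin by (simp add: linear_subspace_image)
  then have "dim W + DIM('b) = DIM('a)"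
    using dim_subspace_orthogonal_to_vectors[of "range \<psi>" UNIV] by (simp add: W_def dim_range)
  moreover have "card J = DIM('a) - DIM('b)"
    unfolding J_def using \<beta> by (simp add: card_Diff_subset card_image)
  moreover have "dim (span J) = card J"
    unfolding dim_span J_def by (intro dim_eq_card_independent independent_mono[OF independent_Basis]) auto
  ultimately have "dim (span J) = dim W" by linarith
  then obtain f where linf: "linear f" and fW: "f ` span J = W" and fn: "\<And>x. x \<in> span J \<Longrightarrow> norm (f x) = norm x"
    using isometries_subspaces[OF subspace_span subW] by metis
  define \<pi> where "\<pi> = (\<lambda>x. \<Sum>b\<in>Basis. (x \<bullet> \<beta> b) *\<^sub>R b)"
  define \<sigma> where "\<sigma> = (\<lambda>x. \<Sum>i\<in>J. (x \<bullet> i) *\<^sub>R i)"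
  \<comment> \<open>\<open>\<pi>\<close> and \<open>\<sigma>\<close> read off the coordinates in the
    image of \<open>\<beta>\<close> and in \<open>J\<close>. The two summands of \<open>U\<close>
    are orthogonal, so Pythagoras makes \<open>U\<close> an isometry.\<close>
  define U where "U = (\<lambda>x. \<psi> (\<pi> x) + f (\<sigma> x))"
  have lin\<pi>: "linear \<pi>" and lin\<sigma>: "linear \<sigma>"
    unfolding \<pi>_def \<sigma>_def
    by (auto intro!: linearI simp: inner_add_left sum.distrib scaleR_add_left scaleR_right.sum)
  have linU: "linear U"
    unfolding U_def using linear_compose[OF lin\<pi> lin] linear_compose[OF lin\<sigma> linf]
    by (intro linear_compose_add) (auto simp: o_def)
  have \<sigma>J: "\<sigma> x \<in> span J" for x
    unfolding \<sigma>_def by (intro span_sum span_scale span_base)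
  have perp: "\<psi> w \<bullet> f x = 0" if "x \<in> span J" for w x
  proof -
    have "f x \<in> W" using fW that by blast
    then show ?thesis by (simp add: W_def orthogonal_def)
  qed
  have n\<pi>: "(norm (\<pi> x))\<^sup>2 = (\<Sum>b\<in>Basis. (x \<bullet> \<beta> b)\<^sup>2)" for x
    unfolding power2_norm_eq_inner euclidean_inner[of "\<pi> x" "\<pi> x"] by (simp add: \<pi>_def power2_eq_square)
  have n\<sigma>: "(norm (\<sigma> x))\<^sup>2 = (\<Sum>i\<in>J. (x \<bullet> i)\<^sup>2)" for x
    unfolding power2_norm_eq_inner \<sigma>_def using fJ
    by (simp add: inner_sum_left inner_sum_right JJ power2_eq_square if_distrib sum.delta cong: if_cong sum.cong)
  have "(norm (U x))\<^sup>2 = (norm x)\<^sup>2" for x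
  proof -
    have "(norm (U x))\<^sup>2 = (norm (\<psi> (\<pi> x)))\<^sup>2 + (norm (f (\<sigma> x)))\<^sup>2"
      unfolding U_def by (intro norm_add_Pythagorean) (simp add: orthogonal_def perp \<sigma>J)
    also have "\<dots> = (\<Sum>b\<in>Basis. (x \<bullet> \<beta> b)\<^sup>2) + (\<Sum>i\<in>J. (x \<bullet> i)\<^sup>2)"
      by (simp add: iso fn \<sigma>J n\<pi> n\<sigma>)
    also have "\<dots> = (\<Sum>b\<in>\<beta> ` Basis. (x \<bullet> b)\<^sup>2) + (\<Sum>i\<in>J. (x \<bullet> i)\<^sup>2)"
      using \<beta> by (simp add: sum.reindex)
    also have "\<dots> = (\<Sum>b\<in>Basis. (x \<bullet> b)\<^sup>2)"
      using \<beta> by (simp add: J_def sum.subset_diff[OF \<beta>(1)] add.commute)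
    also have "\<dots> = (norm x)\<^sup>2"
      unfolding power2_norm_eq_inner euclidean_inner[of x x] by (simp add: power2_eq_square)
    finally show ?thesis .
  qed
  then have oU: "orthogonal_transformation U"
    by (simp add: orthogonal_transformation linU)
  have U\<beta>: "U (\<beta> b) = \<psi> b" if "b \<in> Basis" for b
  proof -
    have "\<pi> (\<beta> b) = b"
      using that by (simp add: \<pi>_def \<beta>\<beta> if_distrib if_distribR cong: if_cong sum.cong)
    moreover have "\<sigma> (\<beta> b) = 0"
      using that by (simp add: \<sigma>_def \<beta>J)
    ultimately show ?thesis using linear_0[OF linf] by (simp add: U_def)
  qed
  have Ui: "U i = f i" if "i \<in> J" for i
  proof -
    have "\<sigma> i = i"
      using that fJ by (simp add: \<sigma>_def JJ if_distrib if_distribR cong: if_cong sum.cong)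
    moreover have "\<pi> i = 0"
      using that by (simp add: \<pi>_def \<beta>J)
    ultimately show ?thesis using linear_0[OF lin] by (simp add: U_def)
  qed
  have UT: "U ((\<Sum>b\<in>Basis. (w \<bullet> b) *\<^sub>R \<beta> b) + (\<Sum>i\<in>J. t i *\<^sub>R i)) = \<psi> w + (\<Sum>i\<in>J. t i *\<^sub>R f i)" for w t
  proof -
    have "U ((\<Sum>b\<in>Basis. (w \<bullet> b) *\<^sub>R \<beta> b) + (\<Sum>i\<in>J. t i *\<^sub>R i))
        = (\<Sum>b\<in>Basis. (w \<bullet> b) *\<^sub>R \<psi> b) + (\<Sum>i\<in>J. t i *\<^sub>R f i)"
      by (simp add: linear_add[OF linU] linear_sum[OF linU] linear_scale[OF linU] U\<beta> Ui)
    also have "(\<Sum>b\<in>Basis. (w \<bullet> b) *\<^sub>R \<psi> b) = \<psi> (\<Sum>b\<in>Basis. (w \<bullet> b) *\<^sub>R b)"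
      by (simp add: linear_sum[OF lin] linear_scale[OF lin])
    finally show ?thesis by (simp add: euclidean_representation)
  qed
  show ?thesis
  proof (rule that[of J f])
    show "norm (f i) = 1" if "i \<in> J" for i
      using that fn[of i] by (simp add: span_base J_def)
    show "\<psi> w \<bullet> f i = 0" if "i \<in> J" for w i
      using that perp by (simp add: span_base)
    fix h :: "'a \<Rightarrow> ennreal"
    assume hm [measurable]: "h \<in> borel_measurable borel"
    interpret product_sigma_finite "\<lambda>_::'a. lborel :: real measure" ..
    interpret PJ: sigma_finite_measure "\<Pi>\<^sub>M i\<in>J. (lborel :: real measure)"
      by (rule sigma_finite[OF fJ])
    have Um [measurable]: "U \<in> borel_measurable borel"
      using linU by (rule borel_measurable_linear)
    have \<psi>m [measurable]: "\<psi> \<in> borel_measurable borel"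
      using lin by (rule borel_measurable_linear)
    let ?P = "lborel \<Otimes>\<^sub>M (\<Pi>\<^sub>M i\<in>J. (lborel :: real measure))"
    let ?T = "\<lambda>(w, t). (\<Sum>b\<in>Basis. (w \<bullet> b) *\<^sub>R \<beta> b) + (\<Sum>i\<in>J. t i *\<^sub>R i)"
    have "(\<integral>\<^sup>+ z. h z \<partial>lborel) = (\<integral>\<^sup>+ z. h (U z) \<partial>lborel)"
      by (simp add: nn_integral_lborel_orthogonal_transformation[OF oU])
    also have "\<dots> = (\<integral>\<^sup>+ z. h (U z) \<partial>distr ?P borel ?T)"
      unfolding J_def by (simp add: lborel_split_coordinates \<beta>)
    also have "\<dots> = (\<integral>\<^sup>+ p. h (U (?T p)) \<partial>?P)"
      by (rule nn_integral_distr) (unfold split_beta', measurable)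
    also have "\<dots> = (\<integral>\<^sup>+ p. h (\<psi> (fst p) + (\<Sum>i\<in>J. snd p i *\<^sub>R f i)) \<partial>?P)"
      by (simp add: split_beta' UT)
    also have "\<dots> = (\<integral>\<^sup>+ w. (\<integral>\<^sup>+ t. h (\<psi> w + (\<Sum>i\<in>J. t i *\<^sub>R f i)) \<partial>(\<Pi>\<^sub>M i\<in>J. lborel)) \<partial>lborel)"
      by (subst PJ.nn_integral_fst[symmetric]) auto
    finally show "(\<integral>\<^sup>+ z. h z \<partial>lborel)
       = (\<integral>\<^sup>+ w. (\<integral>\<^sup>+ t. h (\<psi> w + (\<Sum>i\<in>J. t i *\<^sub>R f i)) \<partial>(\<Pi>\<^sub>M i\<in>J. lborel)) \<partial>lborel)" .
  qed (rule fJ)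
qed

section \<open>Fourier transforms of compactly supported measures\<close>

lemma fourier_transform_cis:
  "fourier_transform \<mu> z = (\<integral>x. cis (- 2 * pi * (z \<bullet> x)) \<partial>\<mu>)"
  unfolding fourier_transform_def cis_conv_exp by (simp add: mult_ac)

lemma norm_fourier_transform_le:
  assumes "finite_measure \<mu>"
  shows "norm (fourier_transform \<mu> z) \<le> measure \<mu> (space \<mu>)"
  using integral_norm_bound[of \<mu> "\<lambda>x. cis (- 2 * pi * (z \<bullet> x))"] assms
  by (simp add: fourier_transform_cis finite_measure.finite_emeasure_space)

lemma continuous_on_fourier_transform:
  fixes \<mu> :: "'a::euclidean_space measure"
  assumes "finite_measure \<mu>" and [measurable_cong]: "sets \<mu> = sets borel"
  shows "continuous_on UNIV (fourier_transform \<mu>)"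
proof (rule continuous_on_sequentiallyI)
  interpret finite_measure \<mu> by fact
  fix z :: "nat \<Rightarrow> 'a" and y :: 'a
  assume z: "z \<longlonglongrightarrow> y"
  show "(\<lambda>n. fourier_transform \<mu> (z n)) \<longlonglongrightarrow> fourier_transform \<mu> y"
    unfolding fourier_transform_cis
  proof (rule integral_dominated_convergence[where w = "\<lambda>_. 1"])
    show "AE x in \<mu>. (\<lambda>n. cis (- 2 * pi * (z n \<bullet> x))) \<longlonglongrightarrow> cis (- 2 * pi * (y \<bullet> x))"
      using z by (intro AE_I2 tendsto_intros)
  qed auto
qed

lemma fourier_transform_measurable:
  fixes \<mu> :: "'a::euclidean_space measure"
  assumes "finite_measure \<mu>" "sets \<mu> = sets borel"
  shows "fourier_transform \<mu> \<in> borel_measurable borel"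
  using continuous_on_fourier_transform[OF assms] by (rule borel_measurable_continuous_onI)

text \<open>Since the kernel has Fourier transform 1 on the relevant range, the transform of a measure on a ball
  is reproduced by averaging it with the kernel in the directions \<open>u i\<close> only.\<close>

lemma fourier_transform_reproducing:
  fixes \<mu> :: "'a::euclidean_space measure" and g :: "real \<Rightarrow> complex"
  assumes "finite_measure \<mu>" and sets [measurable_cong]: "sets \<mu> = sets borel"
    and supp: "AE x in \<mu>. norm x \<le> R"
    and gm [measurable]: "g \<in> borel_measurable borel" and gint: "integrable lborel g"
    and g: "\<And>x. \<bar>x\<bar> \<le> 2 * pi * R \<Longrightarrow> (\<integral>y. g y * cis (x * y) \<partial>lborel) = 1"
    and J: "finite J" and u: "\<And>i. i \<in> J \<Longrightarrow> norm (u i) = 1"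
  shows "fourier_transform \<mu> v
    = (\<integral>t. (\<Prod>i\<in>J. g (t i)) * fourier_transform \<mu> (v + (\<Sum>i\<in>J. t i *\<^sub>R u i)) \<partial>(\<Pi>\<^sub>M i\<in>J. lborel))"
proof -
  interpret finite_measure \<mu> by fact
  interpret product_sigma_finite "\<lambda>_. lborel :: real measure" ..
  let ?P = "\<Pi>\<^sub>M i\<in>J. (lborel :: real measure)"
  interpret PJ: sigma_finite_measure ?P
    by (rule sigma_finite[OF J])
  interpret PM: pair_sigma_finite ?P \<mu> ..
  let ?f = "\<lambda>t x. (\<Prod>i\<in>J. g (t i)) * cis (- 2 * pi * ((v + (\<Sum>i\<in>J. t i *\<^sub>R u i)) \<bullet> x))"
  have Gint: "integrable ?P (\<lambda>t. \<Prod>i\<in>J. g (t i))"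
    using J gint by (rule product_integrable_prod)
  have "integrable (?P \<Otimes>\<^sub>M \<mu>) (case_prod ?f)"
  proof (rule PM.Fubini_integrable)
    show "integrable ?P (\<lambda>t. \<integral>x. norm (case_prod ?f (t, x)) \<partial>\<mu>)"
      using Gint by (simp add: norm_mult)
    show "AE t in ?P. integrable \<mu> (\<lambda>x. case_prod ?f (t, x))"
      by (intro AE_I2) (auto intro!: integrable_const_bound[where B = "norm (\<Prod>i\<in>J. g (t i))" for t] simp: norm_mult)
  qed (unfold split_beta', measurable)
  then have "(\<integral>t. (\<integral>x. ?f t x \<partial>\<mu>) \<partial>?P) = (\<integral>x. (\<integral>t. ?f t x \<partial>?P) \<partial>\<mu>)"
    by (rule PM.Fubini_integral[symmetric])
  also have "\<dots> = (\<integral>x. cis (- 2 * pi * (v \<bullet> x)) \<partial>\<mu>)"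
  proof (rule integral_cong_AE)
    show "AE x in \<mu>. (\<integral>t. ?f t x \<partial>?P) = cis (- 2 * pi * (v \<bullet> x))"
      using supp
    proof eventually_elim
      case (elim x)
      \<comment> \<open>The character splits over \<open>J\<close>, so for fixed x the integral in t
        is a product of transforms of \<open>g\<close> at the frequencies -2 pi (u i . x). By
        Cauchy-Schwarz these are at most 2 pi R in modulus, where the transform is 1.\<close>
      have "?f t x = cis (- 2 * pi * (v \<bullet> x)) * (\<Prod>i\<in>J. g (t i) * cis (- 2 * pi * (u i \<bullet> x) * t i))" for t
      proof -
        have "- 2 * pi * ((v + (\<Sum>i\<in>J. t i *\<^sub>R u i)) \<bullet> x)
            = - 2 * pi * (v \<bullet> x) + (\<Sum>i\<in>J. - 2 * pi * (u i \<bullet> x) * t i)"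
          by (simp add: inner_add_left inner_sum_left sum_distrib_left distrib_left sum_negf mult_ac)
        moreover have "cis (\<Sum>i\<in>J. - 2 * pi * (u i \<bullet> x) * t i) = (\<Prod>i\<in>J. cis (- 2 * pi * (u i \<bullet> x) * t i))"
          using J by (simp add: cis_conv_exp sum_distrib_left exp_sum)
        ultimately show ?thesis
          by (simp only: cis_mult[symmetric] prod.distrib mult_ac)
      qed
      then have "(\<integral>t. ?f t x \<partial>?P)
          = cis (- 2 * pi * (v \<bullet> x)) * (\<integral>t. (\<Prod>i\<in>J. g (t i) * cis (- 2 * pi * (u i \<bullet> x) * t i)) \<partial>?P)"
        by simp
      also have "(\<integral>t. (\<Prod>i\<in>J. g (t i) * cis (- 2 * pi * (u i \<bullet> x) * t i)) \<partial>?P)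
          = (\<Prod>i\<in>J. \<integral>y. g y * cis (- 2 * pi * (u i \<bullet> x) * y) \<partial>lborel)"
      proof (rule product_integral_prod[OF J])
        show "integrable lborel (\<lambda>y. g y * cis (- 2 * pi * (u i \<bullet> x) * y))" for i
          by (rule Bochner_Integration.integrable_bound[OF gint]) (auto simp: norm_mult)
      qed
      also have "\<dots> = 1"
      proof (intro prod.neutral ballI g)
        fix i assume "i \<in> J"
        then have "\<bar>u i \<bullet> x\<bar> \<le> R"
          using Cauchy_Schwarz_ineq2[of "u i" x] u[of i] elim by simp
        then show "\<bar>- 2 * pi * (u i \<bullet> x)\<bar> \<le> 2 * pi * R"
          by (simp add: abs_mult)
      qed
      finally show ?case by simp
    qed
  qed measurable
  finally show ?thesis
    unfolding fourier_transform_cis by simp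
qed

text \<open>Jensen's inequality for the weight \<open>G\<close>; the power of its mass appears
  because \<open>G\<close> is not normalised. The bound on \<open>h\<close> supplies integrability
  and shows that \<open>A > 0\<close> forces \<open>I > 0\<close>.\<close>

lemma powr_integral_le_weighted:
  fixes G h :: "'x \<Rightarrow> real"
  assumes p: "1 < p" and G: "integrable M G" "\<And>x. 0 \<le> G x"
    and hm [measurable]: "h \<in> borel_measurable M" and h: "\<And>x. 0 \<le> h x" "\<And>x. h x \<le> B"
  shows "(\<integral>x. G x * h x \<partial>M) powr p
    \<le> (\<integral>x. G x \<partial>M) powr (p - 1) * (\<integral>x. G x * h x powr p \<partial>M)"
proof -
  have Gm [measurable]: "G \<in> borel_measurable M" using G by auto
  have B: "0 \<le> B" using h order_trans by blast
  define A where "A = (\<integral>x. G x * h x \<partial>M)"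
  define I where "I = (\<integral>x. G x \<partial>M)"
  define K where "K = (\<integral>x. G x * h x powr p \<partial>M)"
  have int: "integrable M (\<lambda>x. G x * k x)" if [measurable]: "k \<in> borel_measurable M" and "\<And>x. 0 \<le> k x" "\<And>x. k x \<le> D" for k D
  proof (rule Bochner_Integration.integrable_bound[OF integrable_mult_left[OF G(1), of D]])
    show "AE x in M. norm (G x * k x) \<le> norm (G x * D)"
      using that G(2) order_trans[OF that(2,3)] by (intro AE_I2) (simp add: abs_mult mult_left_mono)
  qed measurable
  have int1: "integrable M (\<lambda>x. G x * h x)" using h by (intro int) auto
  have int2: "integrable M (\<lambda>x. G x * h x powr p)"
    using h p by (intro int[where D = "B powr p"]) (auto intro: powr_mono2)
  have I: "0 \<le> I" unfolding I_def using G by simp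
  have A: "0 \<le> A" unfolding A_def using G h by simp
  have K: "0 \<le> K" unfolding K_def using G by simp
  have "A \<le> (\<integral>x. G x * B \<partial>M)"
    unfolding A_def using G h by (intro integral_mono int1) (auto intro: mult_left_mono)
  then have AI: "A \<le> I * B" by (simp add: I_def)
  show ?thesis
  proof (cases "A = 0")
    case False
    with A have A0: "0 < A" by simp
    with AI B I have I0: "0 < I"
      by (metis less_eq_real_def mult_zero_left not_le)
    \<comment> \<open>\<open>m\<close> is the weighted mean of \<open>h\<close>. Young's inequality
      with \<open>m powr (p - 1)\<close> is then the tangent-line bound of the p-th power at
      \<open>m\<close>; integrating it against \<open>G\<close> gives
      \<open>I * m powr p \<le> K\<close>.\<close>
    define m where "m = A / I"
    have m: "0 < m" using A0 I0 by (simp add: m_def)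
    define q where "q = p / (p - 1)"
    have q: "1 < q" "1 / p + 1 / q = 1" and pq: "(p - 1) * q = p"
      using p by (auto simp: q_def field_simps)
    have young: "h x * m powr (p - 1) \<le> h x powr p / p + m powr p / q" for x
      using Youngs_inequality[OF p q, of "h x" "m powr (p - 1)"] h by (simp add: powr_powr pq)
    have "A * m powr (p - 1) = (\<integral>x. G x * (h x * m powr (p - 1)) \<partial>M)"
      by (simp add: A_def mult.assoc flip: integral_mult_left_zero)
    also have "\<dots> \<le> (\<integral>x. G x * (h x powr p / p + m powr p / q) \<partial>M)"
      using int1 int2 G young
      by (intro integral_mono mult_left_mono)
        (auto simp: distrib_left mult.assoc[symmetric])
    also have "\<dots> = K / p + I * (m powr p / q)"
      using int2 G(1) by (simp add: distrib_left K_def I_def)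
    finally have 1: "A * m powr (p - 1) \<le> K / p + I * (m powr p / q)" .
    have "m powr p = m * m powr (p - 1)"
      using m by (simp add: powr_mult_base)
    then have 2: "A * m powr (p - 1) = I * m powr p"
      using I0 by (simp add: m_def)
    have "1 / q = 1 - 1 / p" using q by simp
    then have "I * (m powr p / q) = I * m powr p - I * m powr p / p"
      by (metis (no_types, opaque_lifting) mult.right_neutral right_diff_distrib times_divide_eq_right)
    with 1 2 have "I * m powr p / p \<le> K / p" by linarith
    then have IK: "I * m powr p \<le> K"
      using p by (simp add: divide_le_cancel)
    have "A powr p = I powr p * m powr p"
      using A0 I0 by (simp add: m_def powr_divide)
    also have "\<dots> = I powr (p - 1) * (I * m powr p)"
      using powr_mult_base[of I "p - 1"] I0 by (simp add: mult.commute)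
    also have "\<dots> \<le> I powr (p - 1) * K"
      using IK by (intro mult_left_mono) auto
    finally show ?thesis by (simp add: A_def I_def K_def)
  next
    case True
    then show ?thesis
      using K by (simp flip: A_def I_def K_def)
  qed
qed

section \<open>Restriction of the energy integral to a subspace\<close>

text \<open>A non-integrable function has Bochner integral 0 by convention; for an integrable one
  the two sides agree.\<close>

lemma ennreal_integral_le_nn_integral:
  fixes f :: "'x \<Rightarrow> real"
  assumes "\<And>x. 0 \<le> f x"
  shows "ennreal (\<integral>x. f x \<partial>M) \<le> (\<integral>\<^sup>+ x. ennreal (f x) \<partial>M)"
proof (cases "integrable M f")
  case True
  then show ?thesis using assms by (simp add: nn_integral_eq_integral)
qed (simp add: not_integrable_integral_eq)

text \<open>With \<open>x i\<close> the modulus of the i-th coordinate, this converts decay of the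
  product kernel in each coordinate into decay in the norm.\<close>

lemma one_plus_sum_le_prod:
  fixes x :: "'i \<Rightarrow> real"
  assumes "finite J" "\<And>i. 0 \<le> x i"
  shows "1 + (\<Sum>i\<in>J. x i) \<le> (\<Prod>i\<in>J. 1 + x i)"
  using assms(1)
proof induction
  case (insert j J)
  have "1 + (\<Sum>i\<in>insert j J. x i) \<le> (1 + x j) * (1 + (\<Sum>i\<in>J. x i))"
    using insert.hyps assms(2) by (simp add: algebra_simps sum_nonneg)
  also have "\<dots> \<le> (1 + x j) * (\<Prod>i\<in>J. 1 + x i)"
    using insert.IH assms(2)[of j] by (intro mult_left_mono) auto
  finally show ?case using insert.hyps by simp
qed simp

text \<open>The kernel is at most \<open>C ^ card J / Q ^ n\<close> with \<open>Q\<close> at least 1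
  + |y|. If a >= 0, orthogonality gives |x| <= |x + y|, and 1 / Q^n <= 1. If a < 0, then |x| >= 1
  gives |x + y| <= |x| (1 + |y|), and Q^n outweighs (1 + |y|)^(-a) because n >= -a.\<close>

lemma powr_norm_mult_kernel_le:
  fixes x y :: "'a::real_inner" and g :: "real \<Rightarrow> complex"
  assumes "1 \<le> norm x" "x \<bullet> y = 0" "norm y \<le> (\<Sum>i\<in>J. \<bar>t i\<bar>)" "finite J" "- a \<le> real n"
    and g: "\<And>y. norm (g y) \<le> C / (1 + \<bar>y\<bar>) ^ n"
  shows "norm x powr a * norm (\<Prod>i\<in>J. g (t i)) \<le> C ^ card J * norm (x + y) powr a"
proof -
  define Q where "Q = (\<Prod>i\<in>J. 1 + \<bar>t i\<bar>)"
  have C: "0 \<le> C" using g[of 0] order_trans[OF norm_ge_zero] by fastforce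
  have Q: "1 + norm y \<le> Q"
    unfolding Q_def using one_plus_sum_le_prod[OF assms(4), of "\<lambda>i. \<bar>t i\<bar>"] assms(3) by simp
  then have Q1: "1 \<le> Q"
    using norm_ge_zero[of y] by linarith
  have "norm (\<Prod>i\<in>J. g (t i)) \<le> (\<Prod>i\<in>J. C / (1 + \<bar>t i\<bar>) ^ n)"
    unfolding prod_norm[symmetric] by (intro prod_mono) (auto simp: g)
  also have "\<dots> = C ^ card J / Q ^ n"
    by (simp add: prod_dividef Q_def prod_power_distrib)
  finally have G: "norm (\<Prod>i\<in>J. g (t i)) \<le> C ^ card J / Q ^ n" .
  have "norm x powr a / Q ^ n \<le> norm (x + y) powr a"
  proof (cases "0 \<le> a")
    case True
    have "(norm (x + y))\<^sup>2 = (norm x)\<^sup>2 + (norm y)\<^sup>2"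
      using assms(2) by (intro norm_add_Pythagorean) (simp add: orthogonal_def)
    then have "norm x \<le> norm (x + y)"
      by (intro power2_le_imp_le[of "norm x"]) auto
    then have "norm x powr a \<le> norm (x + y) powr a"
      using True by (intro powr_mono2) auto
    moreover have "norm x powr a / Q ^ n \<le> norm x powr a / 1"
      using Q1 by (intro divide_left_mono one_le_power) auto
    ultimately show ?thesis by simp
  next
    case False
    have "norm (x + y) \<le> norm x + 1 * norm y"
      using norm_triangle_ineq[of x y] by simp
    also have "\<dots> \<le> norm x + norm x * norm y"
      using assms(1) by (intro add_left_mono mult_right_mono) auto
    finally have "norm (x + y) \<le> norm x * (1 + norm y)"
      by (simp add: algebra_simps)
    \<comment> \<open>Antitonicity of \<open>powr\<close> for a negative exponent fails at base 0,
      where \<open>powr\<close> has the value 0.\<close>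
    moreover have "0 < norm (x + y)"
    proof -
      have "(norm (x + y))\<^sup>2 = (norm x)\<^sup>2 + (norm y)\<^sup>2"
        using assms(2) by (intro norm_add_Pythagorean) (simp add: orthogonal_def)
      then show ?thesis using assms(1)
        by (metis norm_zero not_one_le_zero power_zero_numeral sum_power2_eq_zero_iff zero_less_norm_iff)
    qed
    ultimately have "(norm x * (1 + norm y)) powr a \<le> norm (x + y) powr a"
      using False by (intro powr_mono2') auto
    moreover have "1 / Q ^ n \<le> (1 + norm y) powr a"
    proof -
      have "1 / Q ^ n \<le> 1 / (1 + norm y) ^ n"
        using Q Q1 by (intro divide_left_mono power_mono mult_pos_pos zero_less_power add_pos_nonneg) auto
      also have "\<dots> = (1 + norm y) powr (- real n)"
        by (simp add: powr_minus_divide powr_realpow add_pos_nonneg)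
      also have "\<dots> \<le> (1 + norm y) powr a"
        using assms(5) by (intro powr_mono) auto
      finally show ?thesis .
    qed
    then have "norm x powr a * (1 / Q ^ n) \<le> norm x powr a * (1 + norm y) powr a"
      by (intro mult_left_mono) auto
    ultimately show ?thesis
      by (simp add: powr_mult)
  qed
  then have "C ^ card J * (norm x powr a / Q ^ n) \<le> C ^ card J * norm (x + y) powr a"
    using C by (intro mult_left_mono) auto
  moreover have "norm x powr a * norm (\<Prod>i\<in>J. g (t i)) \<le> norm x powr a * (C ^ card J / Q ^ n)"
    using G by (intro mult_left_mono) auto
  ultimately show ?thesis by (simp add: mult.commute)
qed

text \<open>For a < 0 a dyadic decomposition: where 2^(-n-1) <= |w| < 2^(-n) the integrand is at
  most 2^(-(n+1)a), and the enclosing ball has volume of order 2^(-nk). The resulting series is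
  geometric with ratio 2^(-(a+k)) < 1.\<close>

lemma nn_integral_norm_powr_ball_finite:
  fixes a :: real
  assumes "- real DIM('b) < a"
  shows "(\<integral>\<^sup>+ w. ennreal (norm w powr a) * indicator (ball 0 1) w \<partial>(lborel :: 'b::euclidean_space measure)) < \<infinity>"
    (is "?I < _")
proof (cases "0 \<le> a")
  case True
  have "?I \<le> (\<integral>\<^sup>+ w. indicator (ball 0 1) w \<partial>(lborel :: 'b measure))"
    using True by (intro nn_integral_mono) (auto simp: indicator_def powr_le1)
  also have "\<dots> < \<infinity>"
    by (simp add: emeasure_lborel_ball_finite[unfolded infinity_ennreal_def])
  finally show ?thesis .
next
  case False
  define k where "k = DIM('b)"
  define c where "c = (\<lambda>n. ((1/2) ^ Suc n) powr a * (unit_ball_vol (real k) * ((1/2::real) ^ n) ^ k))"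
  have "?I \<le> (\<integral>\<^sup>+ w. (\<Sum>n. ennreal (((1/2) ^ Suc n) powr a) * indicator (ball 0 ((1/2) ^ n)) w) \<partial>(lborel :: 'b measure))"
  proof (rule nn_integral_mono)
    fix w :: 'b
    let ?g = "\<lambda>n. ennreal (((1/2) ^ Suc n) powr a) * indicator (ball 0 ((1/2) ^ n)) w"
    show "ennreal (norm w powr a) * indicator (ball 0 1) w \<le> (\<Sum>n. ?g n)"
    proof (cases "w \<noteq> 0 \<and> norm w < 1")
      case True
      \<comment> \<open>As |w| < 1, the least such exponent is positive, and its predecessor is the
        index of the dyadic shell containing w.\<close>
      define N where "N = (LEAST n. (1/2) ^ n \<le> norm w)"
      have "\<exists>n. (1/2::real) ^ n \<le> norm w"
        using real_arch_pow_inv[of "norm w" "1/2"] True by (auto intro: less_imp_le)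
      then have N: "(1/2) ^ N \<le> norm w"
        unfolding N_def by (rule LeastI_ex)
      then obtain n where n: "N = Suc n"
        using True by (cases N) auto
      have "\<not> (1/2) ^ n \<le> norm w"
        using not_less_Least[of n "\<lambda>n. (1/2) ^ n \<le> norm w"] n by (simp add: N_def)
      then have "w \<in> ball 0 ((1/2) ^ n)" by simp
      moreover have "norm w powr a \<le> ((1/2) ^ Suc n) powr a"
        using N n False by (intro powr_mono2') auto
      ultimately have "ennreal (norm w powr a) * indicator (ball 0 1) w \<le> ?g n"
        using True by (simp add: ennreal_leI)
      also have "?g n \<le> (\<Sum>n. ?g n)"
      proof -
        have "f n \<le> (\<Sum>n. f n)" for f :: "nat \<Rightarrow> ennreal"
          using sum_le_suminf[of f "{n}"] by simp
        then show ?thesis .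
      qed
      finally show ?thesis .
    qed auto
  qed
  also have "\<dots> = (\<Sum>n. ennreal (((1/2) ^ Suc n) powr a) * emeasure lborel (ball (0::'b) ((1/2) ^ n)))"
  proof (subst nn_integral_suminf)
    show "(\<lambda>w. ennreal (((1/2) ^ Suc n) powr a) * indicator (ball 0 ((1/2) ^ n)) w) \<in> borel_measurable (lborel :: 'b measure)" for n
      by (intro borel_measurable_times_ennreal borel_measurable_const borel_measurable_indicator) simp
    show "(\<Sum>n. \<integral>\<^sup>+ w. ennreal (((1/2) ^ Suc n) powr a) * indicator (ball 0 ((1/2) ^ n)) w \<partial>(lborel :: 'b measure))
      = (\<Sum>n. ennreal (((1/2) ^ Suc n) powr a) * emeasure lborel (ball (0::'b) ((1/2) ^ n)))"
      by (rule suminf_cong, rule nn_integral_cmult_indicator) simp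
  qed
  also have "\<dots> = (\<Sum>n. ennreal (c n))"
    by (rule suminf_cong) (simp only: emeasure_ball c_def k_def ennreal_mult' powr_ge_zero zero_le_power zero_le_divide_1_iff zero_le_numeral)
  also have "\<dots> < \<infinity>"
  proof -
    define r where "r = (1/2::real) powr (a + real k)"
    have "r < 1"
      using assms powr_less_mono2[of "a + real k" "1/2" 1] by (simp add: r_def k_def)
    have "c n = (1/2) powr a * unit_ball_vol (real k) * r ^ n" for n
    proof -
      have pow: "(x ^ m) powr a = (x powr a) ^ m" if "0 < x" for x :: real and m
        using that by (induction m) (simp_all add: powr_mult)
      have "(x ^ Suc n) powr a * (x ^ n) ^ k = x powr a * (x powr (a + real k)) ^ n" if "0 < x" for x :: real
      proof -
        have 1: "(x ^ n) ^ k = (x ^ k) ^ n"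
          by (metis power_mult mult.commute)
        have 2: "x powr (a + real k) = x powr a * x ^ k"
          using that by (simp add: powr_add powr_realpow)
        show ?thesis
          unfolding pow[OF that] 1 2 power_mult_distrib by simp
      qed
      from this[of "1/2"] have "((1/2) ^ Suc n) powr a * ((1/2::real) ^ n) ^ k = (1/2) powr a * r ^ n"
        unfolding r_def by linarith
      then show ?thesis
        unfolding c_def mult.left_commute[of _ "unit_ball_vol (real k)"] by simp
    qed
    then have "c = (\<lambda>n. (1/2) powr a * unit_ball_vol (real k) * r ^ n)" by blast
    moreover have "norm r < 1" using \<open>r < 1\<close> by (simp add: r_def)
    ultimately have "summable c"
      by (metis summable_mult summable_geometric)
    moreover have "0 \<le> c n" for n by (simp add: c_def)
    ultimately have "(\<Sum>n. ennreal (c n)) \<noteq> top"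
      by (rule ennreal_suminf_neq_top)
    then show ?thesis
      by (simp only: less_top infinity_ennreal_def)
  qed
  finally show ?thesis .
qed

text \<open>\<open>\<psi>\<close> parametrises V by R^k, so the conclusion concerns the integral
  over V written in R^k.\<close>

lemma nn_integral_fourier_isometry_finite:
  fixes \<mu> :: "'a::euclidean_space measure" and \<psi> :: "'b::euclidean_space \<Rightarrow> 'a"
  defines "F \<equiv> fourier_transform \<mu>"
  assumes fin: "finite_measure \<mu>" and sets: "sets \<mu> = sets borel" and supp: "AE x in \<mu>. norm x \<le> R"
    and lin: "linear \<psi>" and iso: "\<And>w. norm (\<psi> w) = norm w"
    and p: "1 < p" and a: "- real DIM('b) < a"
    and energy: "(\<integral>\<^sup>+ z. ennreal (norm (F z) powr p * norm z powr a) \<partial>lborel) < \<infinity>"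
  shows "(\<integral>\<^sup>+ w. ennreal (norm (F (\<psi> w)) powr p * norm w powr a) \<partial>lborel) < \<infinity>"
proof -
  have Fm [measurable]: "F \<in> borel_measurable borel"
    unfolding F_def using fin sets by (rule fourier_transform_measurable)
  have \<psi>m [measurable]: "\<psi> \<in> borel_measurable borel"
    using lin by (rule borel_measurable_linear)
  define M where "M = measure \<mu> (space \<mu>)"
  have FM: "norm (F z) \<le> M" for z
    unfolding F_def M_def using fin by (rule norm_fourier_transform_le)
  obtain J :: "'a set" and u where J: "finite J" and u1: "\<And>i. i \<in> J \<Longrightarrow> norm (u i) = 1"
    and perp: "\<And>w i. i \<in> J \<Longrightarrow> \<psi> w \<bullet> u i = 0"
    and split: "\<And>h. h \<in> borel_measurable borel \<Longrightarrow> (\<integral>\<^sup>+ z. h z \<partial>lborel)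
       = (\<integral>\<^sup>+ w. (\<integral>\<^sup>+ t. h (\<psi> w + (\<Sum>i\<in>J. t i *\<^sub>R u i)) \<partial>(\<Pi>\<^sub>M i\<in>J. lborel)) \<partial>lborel)"
    using isometry_coordinates[OF lin iso] by blast
  \<comment> \<open>At least 2 to start \<open>smoothing_kernel\<close>, and at least -a to absorb
    the ratio of the weights.\<close>
  define n where "n = 2 + nat \<lceil>- a\<rceil>"
  have n: "2 \<le> n" "- a \<le> real n" unfolding n_def by linarith+
  \<comment> \<open>The absolute value and the summand 1 make the radius positive whatever the sign
    of \<open>R\<close>.\<close>
  obtain g :: "real \<Rightarrow> complex" and C where gm [measurable]: "g \<in> borel_measurable borel"
    and gb: "\<And>y. norm (g y) \<le> C / (1 + \<bar>y\<bar>) ^ n"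
    and g1: "\<And>x. \<bar>x\<bar> \<le> 2 * pi * \<bar>R\<bar> + 1 \<Longrightarrow> (\<integral>y. g y * cis (x * y) \<partial>lborel) = 1"
    using smoothing_kernel[OF n(1), of "2 * pi * \<bar>R\<bar> + 1"] by (auto simp: add_nonneg_pos)
  have gint: "integrable lborel g"
    using integrable_mult_cis[OF gm gb n(1), of 0] by simp
  have C: "0 \<le> C" using gb[of 0] order_trans[OF norm_ge_zero] by fastforce
  interpret product_sigma_finite "\<lambda>_::'a. lborel :: real measure" ..
  let ?P = "\<Pi>\<^sub>M i\<in>J. (lborel :: real measure)"
  interpret PJ: sigma_finite_measure ?P
    by (rule sigma_finite[OF J])
  define G where "G = (\<lambda>t. \<Prod>i\<in>J. g (t i))"
  define U where "U = (\<lambda>t. \<Sum>i\<in>J. t i *\<^sub>R u i)"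
  have Gm [measurable]: "G \<in> borel_measurable ?P" unfolding G_def by measurable
  have Um [measurable]: "U \<in> borel_measurable ?P" unfolding U_def by measurable
  have Gint: "integrable ?P (\<lambda>t. norm (G t))"
    unfolding G_def using product_integrable_prod[OF J gint] by (rule integrable_norm)
  \<comment> \<open>\<open>G\<close> integrates to 1 but its modulus may have larger mass; this is
    the price in Jensen's inequality.\<close>
  define D where "D = (\<integral>t. norm (G t) \<partial>?P) powr (p - 1)"
  define H where "H = (\<lambda>z. ennreal (norm (F z) powr p * norm z powr a))"
  have Hm [measurable]: "H \<in> borel_measurable borel" unfolding H_def by measurable
  have outer: "ennreal (norm (F (\<psi> w)) powr p * norm w powr a)
      \<le> ennreal (D * C ^ card J) * (\<integral>\<^sup>+ t. H (\<psi> w + U t) \<partial>?P)" if w: "1 \<le> norm w" for w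
  proof -
    let ?h = "\<lambda>t. norm (F (\<psi> w + U t))"
    have "F (\<psi> w) = (\<integral>t. G t * F (\<psi> w + U t) \<partial>?P)"
      unfolding F_def G_def U_def
      using supp by (intro fourier_transform_reproducing[where R = "\<bar>R\<bar>"] fin sets gm gint g1 J u1) (auto elim: eventually_mono)
    then have "norm (F (\<psi> w)) \<le> (\<integral>t. norm (G t) * ?h t \<partial>?P)"
      using integral_norm_bound[of ?P "\<lambda>t. G t * F (\<psi> w + U t)"] by (simp add: norm_mult)
    then have "norm (F (\<psi> w)) powr p \<le> (\<integral>t. norm (G t) * ?h t \<partial>?P) powr p"
      using p by (intro powr_mono2) auto
    also have "\<dots> \<le> D * (\<integral>t. norm (G t) * ?h t powr p \<partial>?P)"
      unfolding D_def using Gint FM p by (intro powr_integral_le_weighted[where B = M]) auto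
    finally have "norm (F (\<psi> w)) powr p * norm w powr a
        \<le> D * (\<integral>t. norm (G t) * ?h t powr p \<partial>?P) * norm w powr a"
      by (intro mult_right_mono) auto
    also have "\<dots> = D * (\<integral>t. norm w powr a * norm (G t) * ?h t powr p \<partial>?P)"
      by (simp add: mult_ac flip: integral_mult_right_zero)
    finally have "ennreal (norm (F (\<psi> w)) powr p * norm w powr a)
        \<le> ennreal D * ennreal (\<integral>t. norm w powr a * norm (G t) * ?h t powr p \<partial>?P)"
      by (simp add: D_def ennreal_leI flip: ennreal_mult')
    also have "ennreal (\<integral>t. norm w powr a * norm (G t) * ?h t powr p \<partial>?P)
        \<le> (\<integral>\<^sup>+ t. ennreal (norm w powr a * norm (G t) * ?h t powr p) \<partial>?P)"
      by (rule ennreal_integral_le_nn_integral) auto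
    also have "\<dots> \<le> (\<integral>\<^sup>+ t. ennreal (C ^ card J) * H (\<psi> w + U t) \<partial>?P)"
    proof (rule nn_integral_mono)
      fix t
      have "norm (U t) \<le> (\<Sum>i\<in>J. \<bar>t i\<bar>)"
        unfolding U_def by (rule order_trans[OF norm_sum]) (simp add: u1)
      moreover have "\<psi> w \<bullet> U t = 0"
        by (simp add: U_def inner_sum_right perp)
      ultimately have "norm (\<psi> w) powr a * norm (G t) \<le> C ^ card J * norm (\<psi> w + U t) powr a"
        unfolding G_def using w by (intro powr_norm_mult_kernel_le[OF _ _ _ J n(2) gb]) (auto simp: iso)
      then have "norm w powr a * norm (G t) * ?h t powr p \<le> C ^ card J * norm (\<psi> w + U t) powr a * ?h t powr p"
        unfolding iso by (intro mult_right_mono) auto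
      then show "ennreal (norm w powr a * norm (G t) * ?h t powr p) \<le> ennreal (C ^ card J) * H (\<psi> w + U t)"
        using C by (simp add: H_def ennreal_leI mult_ac flip: ennreal_mult')
    qed
    also have "\<dots> = ennreal (C ^ card J) * (\<integral>\<^sup>+ t. H (\<psi> w + U t) \<partial>?P)"
      by (rule nn_integral_cmult) measurable
    finally show ?thesis
      using C by (simp add: D_def ennreal_mult' mult.assoc mult_left_mono)
  qed
  have "(\<integral>\<^sup>+ w. ennreal (norm (F (\<psi> w)) powr p * norm w powr a) \<partial>lborel)
      \<le> (\<integral>\<^sup>+ w. ennreal (M powr p) * (ennreal (norm w powr a) * indicator (ball 0 1) w)
            + ennreal (D * C ^ card J) * (\<integral>\<^sup>+ t. H (\<psi> w + U t) \<partial>?P) \<partial>lborel)"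
  proof (rule nn_integral_mono)
    fix w :: 'b
    show "ennreal (norm (F (\<psi> w)) powr p * norm w powr a)
      \<le> ennreal (M powr p) * (ennreal (norm w powr a) * indicator (ball 0 1) w)
            + ennreal (D * C ^ card J) * (\<integral>\<^sup>+ t. H (\<psi> w + U t) \<partial>?P)"
    proof (cases "1 \<le> norm w")
      case True
      then show ?thesis using outer[OF True] by (simp add: add_increasing)
    next
      case False
      have "norm (F (\<psi> w)) powr p * norm w powr a \<le> M powr p * norm w powr a"
        using FM p by (intro mult_right_mono powr_mono2) auto
      then show ?thesis
        using False by (intro add_increasing2) (auto simp: ennreal_leI simp flip: ennreal_mult')
    qed
  qed
  also have "\<dots> = ennreal (M powr p) * (\<integral>\<^sup>+ w. ennreal (norm w powr a) * indicator (ball 0 1) (w :: 'b) \<partial>lborel)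
      + ennreal (D * C ^ card J) * (\<integral>\<^sup>+ w. (\<integral>\<^sup>+ t. H (\<psi> w + U t) \<partial>?P) \<partial>lborel)"
  proof -
    have [measurable]: "(\<lambda>w. \<integral>\<^sup>+ t. H (\<psi> w + U t) \<partial>?P) \<in> borel_measurable lborel"
      by (rule PJ.borel_measurable_nn_integral) measurable
    have [measurable]: "(\<lambda>w::'b. ennreal (norm w powr a) * indicator (ball 0 1) w) \<in> borel_measurable lborel"
      by (intro borel_measurable_times_ennreal borel_measurable_indicator) (simp, simp)
    have "(\<integral>\<^sup>+ w. ennreal (M powr p) * (ennreal (norm w powr a) * indicator (ball 0 1) (w :: 'b))
            + ennreal (D * C ^ card J) * (\<integral>\<^sup>+ t. H (\<psi> w + U t) \<partial>?P) \<partial>lborel)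
      = (\<integral>\<^sup>+ w. ennreal (M powr p) * (ennreal (norm w powr a) * indicator (ball 0 1) (w :: 'b)) \<partial>lborel)
            + (\<integral>\<^sup>+ w. ennreal (D * C ^ card J) * (\<integral>\<^sup>+ t. H (\<psi> w + U t) \<partial>?P) \<partial>lborel)"
      by (rule nn_integral_add; rule borel_measurable_times_ennreal; (rule borel_measurable_const | fact))
    also have "(\<integral>\<^sup>+ w. ennreal (M powr p) * (ennreal (norm w powr a) * indicator (ball 0 1) (w :: 'b)) \<partial>lborel)
      = ennreal (M powr p) * (\<integral>\<^sup>+ w. ennreal (norm w powr a) * indicator (ball 0 1) (w :: 'b) \<partial>lborel)"
      by (rule nn_integral_cmult) fact
    also have "(\<integral>\<^sup>+ w. ennreal (D * C ^ card J) * (\<integral>\<^sup>+ t. H (\<psi> w + U t) \<partial>?P) \<partial>lborel)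
      = ennreal (D * C ^ card J) * (\<integral>\<^sup>+ w. (\<integral>\<^sup>+ t. H (\<psi> w + U t) \<partial>?P) \<partial>lborel)"
      by (rule nn_integral_cmult) fact
    finally show ?thesis .
  qed
  also have "(\<integral>\<^sup>+ w. (\<integral>\<^sup>+ t. H (\<psi> w + U t) \<partial>?P) \<partial>lborel) = (\<integral>\<^sup>+ z. H z \<partial>lborel)"
    unfolding U_def by (rule split[OF Hm, symmetric])
  also have "ennreal (M powr p) * (\<integral>\<^sup>+ w. ennreal (norm w powr a) * indicator (ball 0 1) (w :: 'b) \<partial>lborel)
      + ennreal (D * C ^ card J) * (\<integral>\<^sup>+ z. H z \<partial>lborel) < \<infinity>"
    using nn_integral_norm_powr_ball_finite[OF a] energy
    by (simp add: H_def ennreal_mult_less_top ennreal_add_less_top)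
  finally show ?thesis .
qed

section \<open>Spectra of projections\<close>

lemma ennreal_powr_less_top_iff: "ennreal_powr x a < \<infinity> \<longleftrightarrow> x < \<infinity>"
  by (simp add: ennreal_powr_def less_top)

text \<open>\<open>X\<close> differs from the Borel set \<open>K\<close> by a subset of the null set
  \<open>- K\<close>, so its completed mass is the total mass. From here on the completion no longer
  appears.\<close>

lemma cs_measures_iff:
  "\<mu> \<in> cs_measures X \<longleftrightarrow> sets \<mu> = sets borel \<and> (\<exists>K. compact K \<and> K \<subseteq> X \<and> emeasure \<mu> (- K) = 0) \<and>
     0 < emeasure \<mu> UNIV \<and> emeasure \<mu> UNIV < \<infinity>"
proof -
  have "emeasure (completion \<mu>) X = emeasure \<mu> UNIV"
    if sets: "sets \<mu> = sets borel" and K: "compact K" "K \<subseteq> X" "emeasure \<mu> (- K) = 0" for K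
  proof -
    have K_sets: "K \<in> sets \<mu>" "- K \<in> sets \<mu>"
      using K sets by (auto intro!: borel_compact borel_comp)
    then have null: "- K \<in> null_sets \<mu>"
      using K by auto
    then have "X - K \<in> null_sets (completion \<mu>)"
      by (intro null_sets_completion_subset[OF _ null_sets_completionI[OF null]]) auto
    then have "emeasure (completion \<mu>) (K \<union> (X - K)) = emeasure (completion \<mu>) K"
      using K_sets by (intro emeasure_Un_null_set) auto
    also have "\<dots> = emeasure \<mu> K"
      using K_sets by simp
    also have "\<dots> = emeasure \<mu> (K \<union> - K)"
      using K_sets null by (intro emeasure_Un_null_set[symmetric]) auto
    finally show ?thesis
      using K by (simp add: Un_absorb1 Compl_partition)
  qed
  then show ?thesis
    unfolding cs_measures_def by auto
qed

lemma finite_measure_cs_measures: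
  assumes "\<mu> \<in> cs_measures X"
  shows "finite_measure \<mu>"
  using assms sets_eq_imp_space_eq[of \<mu> borel] by (intro finite_measureI) (auto simp: cs_measures_iff)

text \<open>Near 0 the transform is at least half the total mass. On a ball of radius r the weight
  is at least r^(e-d), apart from the centre, and the volume is of order r^d, so the integral
  exceeds a constant times r^e, which is unbounded as r tends to 0 because e < 0.\<close>

lemma fourier_energy_infinite:
  fixes \<mu> :: "'a::euclidean_space measure"
  assumes \<mu>: "\<mu> \<in> cs_measures UNIV" and \<theta>: "0 < \<theta>" and s: "s < 0"
  shows "fourier_energy s \<theta> \<mu> = \<infinity>"
proof (rule ccontr)
  define d where "d = real DIM('a)"
  define F where "F = fourier_transform \<mu>"
  define e where "e = s / \<theta>"
  have e: "e < 0" using \<theta> s by (simp add: e_def field_simps)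
  have fin: "finite_measure \<mu>" and sets: "sets \<mu> = sets borel"
    using \<mu> finite_measure_cs_measures by (auto simp: cs_measures_iff)
  define m where "m = measure \<mu> UNIV"
  have sp: "space \<mu> = UNIV" using sets_eq_imp_space_eq[OF sets] by simp
  have m: "0 < m"
    using \<mu> fin sp unfolding m_def cs_measures_iff
    by (simp add: finite_measure.emeasure_eq_measure)
  have F0: "F 0 = m"
    unfolding F_def fourier_transform_cis m_def by (simp add: sp scaleR_conv_of_real)
  have Fm [measurable]: "F \<in> borel_measurable borel"
    unfolding F_def using fin sets by (rule fourier_transform_measurable)
  obtain \<delta> where \<delta>: "0 < \<delta>" "\<And>z. norm z < \<delta> \<Longrightarrow> m / 2 \<le> norm (F z)"
  proof -
    have "isCont F 0"
      using continuous_on_fourier_transform[OF fin sets] by (simp add: F_def continuous_on_eq_continuous_at)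
    then obtain \<delta> where "0 < \<delta>" "\<And>z. dist z 0 < \<delta> \<Longrightarrow> dist (F z) (F 0) < m / 2"
      unfolding continuous_at_eps_delta using m by (metis half_gt_zero)
    moreover have "m / 2 \<le> norm (F z)" if "dist (F z) (F 0) < m / 2" for z
      using that norm_triangle_ineq2[of "F 0" "F z"] m by (simp add: F0 dist_norm norm_minus_commute)
    ultimately show ?thesis using that by (metis dist_0_norm dist_commute)
  qed
  let ?I = "\<integral>\<^sup>+ z. ennreal (norm (F z) powr (2 / \<theta>) * norm z powr (e - d)) \<partial>lborel"
  assume "fourier_energy s \<theta> \<mu> \<noteq> \<infinity>"
  then have "?I < \<infinity>"
    using \<theta> unfolding fourier_energy_def
    by (simp add: F_def e_def d_def ennreal_powr_def less_top split: if_splits)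
  then obtain K where K: "?I = ennreal K" "0 \<le> K"
    by (cases ?I) auto
  define c where "c = (m / 2) powr (2 / \<theta>) * unit_ball_vol d"
  have c: "0 < c" using m by (simp add: c_def d_def)
  \<comment> \<open>\<open>x\<close> is the prescribed value of r^e. As e < 0, large
    \<open>x\<close> means small \<open>r\<close>: the first entry ensures
    \<open>r \<le> \<delta>\<close>, the second makes \<open>c * x\<close> exceed
    \<open>K\<close>.\<close>
  define x where "x = max (\<delta> powr e) ((K + 1) / c)"
  define r where "r = x powr (1 / e)"
  have x: "0 < x" using \<delta> by (simp add: x_def less_max_iff_disj)
  then have r: "0 < r" by (simp add: r_def)
  have "r \<le> (\<delta> powr e) powr (1 / e)"
    unfolding r_def x_def using e \<delta> by (intro powr_mono2') (auto simp: divide_nonpos_neg)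
  then have "r \<le> \<delta>"
    using e \<delta> by (simp add: powr_powr)
  have "ennreal (c * x) = ennreal ((m / 2) powr (2 / \<theta>) * r powr (e - d)) * emeasure lborel (ball (0::'a) r)"
  proof -
    have "r powr (e - d) * r ^ DIM('a) = r powr e"
      using r by (simp add: d_def powr_diff powr_realpow)
    also have "\<dots> = x"
      using e x by (simp add: r_def powr_powr)
    finally have "c * x = (m / 2) powr (2 / \<theta>) * r powr (e - d) * (unit_ball_vol d * r ^ DIM('a))"
      by (simp add: c_def)
    then show ?thesis
      using r by (simp add: emeasure_ball d_def ennreal_mult')
  qed
  \<comment> \<open>The centre is removed because \<open>norm z powr (e - d)\<close> is 0 there and
    the lower bound would fail.\<close>
  also have "emeasure lborel (ball (0::'a) r) = emeasure lborel (ball (0::'a) r - {0})"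
    by (subst emeasure_Diff_null_set) (auto intro!: finite_imp_null_set_lborel)
  also have "ennreal ((m / 2) powr (2 / \<theta>) * r powr (e - d)) * \<dots>
      = (\<integral>\<^sup>+ z. ennreal ((m / 2) powr (2 / \<theta>) * r powr (e - d)) * indicator (ball (0::'a) r - {0}) z \<partial>lborel)"
    by (rule nn_integral_cmult_indicator[symmetric]) auto
  also have "\<dots> \<le> ?I"
  proof (rule nn_integral_mono)
    fix z :: 'a
    show "ennreal ((m / 2) powr (2 / \<theta>) * r powr (e - d)) * indicator (ball 0 r - {0}) z
        \<le> ennreal (norm (F z) powr (2 / \<theta>) * norm z powr (e - d))"
    proof (cases "z \<in> ball 0 r - {0}")
      case True
      have "(m / 2) powr (2 / \<theta>) * r powr (e - d) \<le> norm (F z) powr (2 / \<theta>) * norm z powr (e - d)"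
        using True \<delta>(2)[of z] \<open>r \<le> \<delta>\<close> m \<theta> e
        by (intro mult_mono powr_mono2 powr_mono2') (auto simp: d_def)
      with True show ?thesis by (simp add: ennreal_leI)
    qed simp
  qed
  finally have "c * x \<le> K" using K by simp
  moreover have "K + 1 \<le> c * x"
  proof -
    have "(K + 1) / c \<le> x" by (simp add: x_def)
    with c show ?thesis by (simp add: pos_divide_le_eq mult.commute)
  qed
  ultimately show False by simp
qed

text \<open>For theta = 0 the exponent 0 always has finite energy; for theta > 0 no negative
  exponent has. If no exponent at all has finite energy, \<open>sup0\<close> returns 0.\<close>

lemma fourier_spectrum_nonneg:
  fixes \<mu> :: "'a::euclidean_space measure"
  assumes \<mu>: "\<mu> \<in> cs_measures UNIV" and \<theta>: "0 \<le> \<theta>"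
  shows "0 \<le> fourier_spectrum \<theta> \<mu>"
proof -
  have fin: "finite_measure \<mu>"
    using \<mu> by (rule finite_measure_cs_measures)
  have "\<exists>s\<ge>0. fourier_energy s \<theta> \<mu> < \<infinity>" if s: "fourier_energy s \<theta> \<mu> < \<infinity>" for s
  proof (cases "\<theta> = 0")
    case True
    have "fourier_energy 0 \<theta> \<mu> \<le> ennreal ((measure \<mu> (space \<mu>))\<^sup>2)"
      unfolding fourier_energy_def using True norm_fourier_transform_le[OF fin]
      by (auto intro!: SUP_least ennreal_leI power_mono simp: powr_def)
    then show ?thesis
      by (intro exI[of _ 0]) (auto intro: le_less_trans)
  next
    case False
    then show ?thesis
      using fourier_energy_infinite[OF \<mu>, of \<theta> s] s \<theta> by (intro exI[of _ s]) (auto simp: not_less[symmetric])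
  qed
  then have ex: "\<exists>s\<ge>0. fourier_energy s \<theta> \<mu> < \<infinity>" if "\<exists>s. fourier_energy s \<theta> \<mu> < \<infinity>"
    using that by blast
  show ?thesis
  proof (cases "\<exists>s. fourier_energy s \<theta> \<mu> < \<infinity>")
    case True
    then obtain s where s: "0 \<le> s" "fourier_energy s \<theta> \<mu> < \<infinity>"
      using ex by blast
    have "0 \<le> ereal s" using s by simp
    also have "\<dots> \<le> fourier_spectrum \<theta> \<mu>"
      unfolding fourier_spectrum_def sup0_def using s(2) by (auto intro: Sup_upper)
    finally show ?thesis .
  next
    case False
    then show ?thesis by (simp add: fourier_spectrum_def sup0_def)
  qed
qed

text \<open>\<open>\<psi>\<close> inverts \<open>\<phi>\<close> on \<open>V\<close>. Writing P for
  the projection, w . phi (P x) = psi w . P x = psi w . x, since x - P x is orthogonal to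
  \<open>V\<close>. The later lemmas need only a linear isometry \<open>\<psi>\<close> in place of
  \<open>V\<close> and \<open>\<phi>\<close>.\<close>

lemma identification_adjoint:
  fixes V :: "'a::euclidean_space set" and \<phi> :: "'a \<Rightarrow> 'b::euclidean_space"
  assumes V: "subspace V" and \<phi>: "identification V \<phi>"
  shows "\<exists>\<psi> :: 'b \<Rightarrow> 'a. linear \<psi> \<and> (\<forall>w. norm (\<psi> w) = norm w)
    \<and> (\<lambda>x. \<phi> (orth_proj V x)) = adjoint \<psi>"
proof -
  have lin\<phi>: "linear \<phi>" and n\<phi>: "\<And>x. x \<in> V \<Longrightarrow> norm (\<phi> x) = norm x" and im: "\<phi> ` V = UNIV"
    using \<phi> by (auto simp: identification_def)
  have inner\<phi>: "\<phi> x \<bullet> \<phi> y = x \<bullet> y" if "x \<in> V" "y \<in> V" for x y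
    using that V n\<phi> by (simp add: dot_norm subspace_add flip: linear_add[OF lin\<phi>])
  define \<psi> where "\<psi> = inv_into V \<phi>"
  have \<psi>V: "\<psi> w \<in> V" and \<phi>\<psi>: "\<phi> (\<psi> w) = w" for w
    unfolding \<psi>_def using im by (auto intro: inv_into_into f_inv_into_f)
  have inj: "x = y" if "x \<in> V" "y \<in> V" "\<phi> x = \<phi> y" for x y
    using n\<phi>[of "x - y"] that V by (simp add: subspace_diff linear_diff[OF lin\<phi>])
  \<comment> \<open>Both sides of each linearity equation lie in \<open>V\<close> and have the same
    image under \<open>\<phi>\<close>, which is injective on \<open>V\<close>.\<close>
  have lin\<psi>: "linear \<psi>"
    using V by (intro linearI inj)
      (auto simp: \<phi>\<psi> \<psi>V linear_add[OF lin\<phi>] linear_scale[OF lin\<phi>] intro: subspace_add subspace_scale)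
  have n\<psi>: "norm (\<psi> w) = norm w" for w
    using n\<phi>[OF \<psi>V[of w]] by (simp add: \<phi>\<psi>)
  have proj: "orth_proj V x \<in> V \<and> (\<forall>v\<in>V. orthogonal (x - orth_proj V x) v)" for x
    unfolding orth_proj_def
  proof (rule theI')
    obtain y z where "y \<in> span V" "\<And>w. w \<in> span V \<Longrightarrow> orthogonal z w" "x = y + z"
      using orthogonal_subspace_decomp_exists[of V x] by blast
    then have y: "y \<in> V \<and> (\<forall>v\<in>V. orthogonal (x - y) v)"
      using V by (auto simp: span_eq_iff[THEN iffD2])
    moreover have "y' = y" if "y' \<in> V \<and> (\<forall>v\<in>V. orthogonal (x - y') v)" for y'
    proof -
      have "y' - y \<in> V" using that y V by (auto intro: subspace_diff)
      then have "(x - y) \<bullet> (y' - y) = 0" "(x - y') \<bullet> (y' - y) = 0"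
        using that y by (auto simp: orthogonal_def)
      then have "(y' - y) \<bullet> (y' - y) = 0"
        by (simp add: inner_diff_left)
      then show ?thesis by simp
    qed
    ultimately show "\<exists>!y. y \<in> V \<and> (\<forall>v\<in>V. orthogonal (x - y) v)" by blast
  qed
  have "w \<bullet> \<phi> (orth_proj V x) = w \<bullet> adjoint \<psi> x" for w x
  proof -
    have "w \<bullet> \<phi> (orth_proj V x) = \<psi> w \<bullet> orth_proj V x"
      using inner\<phi>[OF \<psi>V[of w], of "orth_proj V x"] proj[of x] by (simp add: \<phi>\<psi>)
    also have "\<dots> = \<psi> w \<bullet> x"
    proof -
      have "(x - orth_proj V x) \<bullet> \<psi> w = 0"
        using proj[of x] \<psi>V[of w] by (auto simp: orthogonal_def)
      then show ?thesis by (simp add: inner_diff_left inner_commute[of "\<psi> w"])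
    qed
    also have "\<dots> = w \<bullet> adjoint \<psi> x"
      by (rule adjoint_works[OF lin\<psi>, symmetric])
    finally show ?thesis .
  qed
  then have "\<phi> (orth_proj V x) = adjoint \<psi> x" for x
    by (metis vector_eq_rdot inner_commute)
  with lin\<psi> n\<psi> show ?thesis by blast
qed

lemma fourier_transform_distr_adjoint:
  fixes \<mu> :: "'a::euclidean_space measure" and \<psi> :: "'b::euclidean_space \<Rightarrow> 'a"
  assumes "linear \<psi>" and [measurable_cong]: "sets \<mu> = sets borel"
  shows "fourier_transform (distr \<mu> borel (adjoint \<psi>)) w = fourier_transform \<mu> (\<psi> w)"
proof -
  have [measurable]: "adjoint \<psi> \<in> borel_measurable borel"
    using adjoint_linear[OF assms(1)]
    by (rule borel_measurable_linear)
  have "w \<bullet> adjoint \<psi> x = \<psi> w \<bullet> x" for x :: 'a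
    by (rule adjoint_works[OF assms(1)])
  then show ?thesis
    unfolding fourier_transform_cis by (subst integral_distr) auto
qed

lemma distr_adjoint_cs_measures:
  fixes \<mu> :: "'a::euclidean_space measure" and \<psi> :: "'b::euclidean_space \<Rightarrow> 'a"
  assumes lin: "linear \<psi>" and \<mu>: "\<mu> \<in> cs_measures X"
  shows "distr \<mu> borel (adjoint \<psi>) \<in> cs_measures (adjoint \<psi> ` X)"
proof -
  have sets [measurable_cong]: "sets \<mu> = sets borel" using \<mu> by (simp add: cs_measures_iff)
  have cont: "continuous_on UNIV (adjoint \<psi>)"
    using adjoint_linear[OF lin] by (simp add: linear_continuous_on linear_conv_bounded_linear)
  then have m [measurable]: "adjoint \<psi> \<in> borel_measurable borel"
    by (rule borel_measurable_continuous_onI)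
  have sp: "space \<mu> = UNIV" using sets_eq_imp_space_eq[OF sets] by simp
  obtain K where K: "compact K" "K \<subseteq> X" "emeasure \<mu> (- K) = 0"
    using \<mu> by (auto simp: cs_measures_iff)
  have K': "compact (adjoint \<psi> ` K)"
    using K cont by (meson compact_continuous_image continuous_on_subset subset_UNIV)
  have "emeasure (distr \<mu> borel (adjoint \<psi>)) (- adjoint \<psi> ` K) = emeasure \<mu> (adjoint \<psi> -` (- adjoint \<psi> ` K))"
    using K' by (subst emeasure_distr) (auto simp: sp intro!: borel_compact borel_comp)
  also have "\<dots> \<le> emeasure \<mu> (- K)"
    using K by (intro emeasure_mono) (auto simp: sets intro!: borel_compact borel_comp)
  finally have "emeasure (distr \<mu> borel (adjoint \<psi>)) (- adjoint \<psi> ` K) = 0"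
    using K by simp
  moreover have "emeasure (distr \<mu> borel (adjoint \<psi>)) UNIV = emeasure \<mu> UNIV"
    by (subst emeasure_distr) (auto simp: sp)
  ultimately show ?thesis
    using \<mu> K K' unfolding cs_measures_iff by (auto intro!: exI[of _ "adjoint \<psi> ` K"])
qed

text \<open>For theta = 0 the shift vanishes and the supremum is taken over fewer points. For theta
  > 0 the shift offsets the change of dimension in the weight, the lower bound on \<open>s\<close>
  is the integrability of that weight at 0, and the power 2 / theta is at least 2, as Jensen's
  inequality requires more than 1.\<close>

lemma fourier_energy_distr_adjoint_finite:
  fixes \<mu> :: "'a::euclidean_space measure" and \<psi> :: "'b::euclidean_space \<Rightarrow> 'a"
  assumes \<mu>: "\<mu> \<in> cs_measures UNIV" and lin: "linear \<psi>" and iso: "\<And>w. norm (\<psi> w) = norm w"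
    and \<theta>: "0 \<le> \<theta>" "\<theta> \<le> 1"
    and s: "\<theta> = 0 \<or> (real DIM('a) - real DIM('b)) * \<theta> < s"
    and fin: "fourier_energy s \<theta> \<mu> < \<infinity>"
  shows "fourier_energy (s - (real DIM('a) - real DIM('b)) * \<theta>) \<theta> (distr \<mu> borel (adjoint \<psi>)) < \<infinity>"
proof -
  have sets: "sets \<mu> = sets borel" using \<mu> by (simp add: cs_measures_iff)
  note ft = fourier_transform_distr_adjoint[OF lin sets]
  show ?thesis
  proof (cases "\<theta> = 0")
    case True
    have "fourier_energy s 0 (distr \<mu> borel (adjoint \<psi>)) \<le> fourier_energy s 0 \<mu>"
      unfolding fourier_energy_def ft by (auto intro!: SUP_least SUP_upper2[of "\<psi> w" for w] simp: iso)
    with fin True show ?thesis by simp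
  next
    case False
    then have \<theta>0: "0 < \<theta>" using \<theta> by simp
    define a where "a = s / \<theta> - real DIM('a)"
    have a: "(s - (real DIM('a) - real DIM('b)) * \<theta>) / \<theta> - real DIM('b) = a"
      using \<theta>0 by (simp add: a_def field_simps)
    have "real DIM('a) - real DIM('b) < s / \<theta>"
      using s False \<theta>0 by (simp add: field_simps)
    then have a_gt: "- real DIM('b) < a"
      by (simp add: a_def)
    obtain K where K: "compact K" "emeasure \<mu> (- K) = 0"
      using \<mu> by (auto simp: cs_measures_iff)
    obtain R where R: "\<And>x. x \<in> K \<Longrightarrow> norm x \<le> R"
      using compact_imp_bounded[OF K(1)] by (auto simp: bounded_iff)
    have "- K \<in> null_sets \<mu>"
      using K sets by (auto intro!: borel_compact borel_comp)
    then have supp: "AE x in \<mu>. norm x \<le> R"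
      by (rule AE_I') (use R in auto)
    have "(\<integral>\<^sup>+ w. ennreal (norm (fourier_transform \<mu> (\<psi> w)) powr (2 / \<theta>) * norm w powr a) \<partial>lborel) < \<infinity>"
    proof (rule nn_integral_fourier_isometry_finite[OF finite_measure_cs_measures[OF \<mu>] sets supp lin iso _ a_gt])
      show "1 < 2 / \<theta>" using \<theta>0 \<theta> by (simp add: field_simps)
      show "(\<integral>\<^sup>+ z. ennreal (norm (fourier_transform \<mu> z) powr (2 / \<theta>) * norm z powr a) \<partial>lborel) < \<infinity>"
        using fin False unfolding fourier_energy_def a_def by (simp only: if_False ennreal_powr_less_top_iff)
    qed
    then show ?thesis
      using False unfolding fourier_energy_def ft by (simp only: if_False ennreal_powr_less_top_iff a)
  qed
qed

text \<open>Each finite-energy exponent \<open>s\<close> is treated separately: above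
  \<open>c\<close>, or for theta = 0, the energy comparison applies; otherwise s - c <= 0, and
  nonnegativity of the projected spectrum suffices.\<close>

lemma fourier_spectrum_distr_adjoint:
  fixes \<mu> :: "'a::euclidean_space measure" and \<psi> :: "'b::euclidean_space \<Rightarrow> 'a"
  assumes \<mu>: "\<mu> \<in> cs_measures UNIV" and lin: "linear \<psi>" and iso: "\<And>w. norm (\<psi> w) = norm w"
    and \<theta>: "0 \<le> \<theta>" "\<theta> \<le> 1" and dim: "DIM('b) \<le> DIM('a)"
  shows "fourier_spectrum \<theta> \<mu> - ereal ((real DIM('a) - real DIM('b)) * \<theta>)
    \<le> fourier_spectrum \<theta> (distr \<mu> borel (adjoint \<psi>))"
proof -
  define c where "c = (real DIM('a) - real DIM('b)) * \<theta>"
  let ?\<nu> = "distr \<mu> borel (adjoint \<psi>)"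
  have c: "0 \<le> c" using dim \<theta> by (simp add: c_def)
  have "?\<nu> \<in> cs_measures UNIV"
    using distr_adjoint_cs_measures[OF lin \<mu>] by (auto simp: cs_measures_iff)
  then have nonneg: "0 \<le> fourier_spectrum \<theta> ?\<nu>"
    using \<theta>(1) by (rule fourier_spectrum_nonneg)
  have "ereal s \<le> fourier_spectrum \<theta> ?\<nu> + ereal c" if s: "fourier_energy s \<theta> \<mu> < \<infinity>" for s
  proof (cases "\<theta> = 0 \<or> c < s")
    case True
    then have "fourier_energy (s - c) \<theta> ?\<nu> < \<infinity>"
      using fourier_energy_distr_adjoint_finite[OF \<mu> lin iso \<theta> _ s] by (simp add: c_def)
    then have "ereal (s - c) \<le> fourier_spectrum \<theta> ?\<nu>"
      unfolding fourier_spectrum_def sup0_def by (auto intro: Sup_upper)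
    then have "ereal (s - c) + ereal c \<le> fourier_spectrum \<theta> ?\<nu> + ereal c"
      by (rule add_right_mono)
    then show ?thesis by simp
  next
    case False
    then have "ereal s \<le> 0 + ereal c" by simp
    also have "\<dots> \<le> fourier_spectrum \<theta> ?\<nu> + ereal c"
      using nonneg by (rule add_right_mono)
    finally show ?thesis .
  qed
  moreover have "0 \<le> fourier_spectrum \<theta> ?\<nu> + ereal c"
    using nonneg c by (simp add: add_nonneg_nonneg)
  ultimately have "fourier_spectrum \<theta> \<mu> \<le> fourier_spectrum \<theta> ?\<nu> + ereal c"
    unfolding fourier_spectrum_def[of \<theta> \<mu>] sup0_def by (auto intro: Sup_least)
  then show ?thesis
    unfolding c_def[symmetric] by (simp add: ereal_minus_le)
qed

text \<open>If the spectrum \<open>?L\<close> of the image is below k, the cap k is attained by no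
  projected measure, so \<open>?L\<close> bounds their uncapped spectra and the inequality for
  measures passes to the supremum.\<close>

lemma fourier_spectrum_set_adjoint:
  fixes X :: "'a::euclidean_space set" and \<psi> :: "'b::euclidean_space \<Rightarrow> 'a"
  assumes lin: "linear \<psi>" and iso: "\<And>w. norm (\<psi> w) = norm w"
    and \<theta>: "0 \<le> \<theta>" "\<theta> \<le> 1" and dim: "DIM('b) \<le> DIM('a)"
  shows "min (ereal (real DIM('b))) (fourier_spectrum_set \<theta> X - ereal ((real DIM('a) - real DIM('b)) * \<theta>))
    \<le> fourier_spectrum_set \<theta> (adjoint \<psi> ` X)"
proof -
  define c where "c = (real DIM('a) - real DIM('b)) * \<theta>"
  let ?L = "fourier_spectrum_set \<theta> (adjoint \<psi> ` X)"
  have c: "0 \<le> c" using dim \<theta> by (simp add: c_def)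
  have L: "min (fourier_spectrum \<theta> \<nu>) (ereal (real DIM('b))) \<le> ?L" if "\<nu> \<in> cs_measures (adjoint \<psi> ` X)" for \<nu>
    using that unfolding fourier_spectrum_set_def sup0_def by (auto intro: Sup_upper)
  have L0: "0 \<le> ?L"
  proof (cases "cs_measures (adjoint \<psi> ` X) = {}")
    case False
    then obtain \<nu> where \<nu>: "\<nu> \<in> cs_measures (adjoint \<psi> ` X)" by blast
    have "0 \<le> min (fourier_spectrum \<theta> \<nu>) (ereal (real DIM('b)))"
      using fourier_spectrum_nonneg[OF _ \<theta>(1), of \<nu>] \<nu> by (auto simp: cs_measures_iff)
    with L[OF \<nu>] show ?thesis by (rule order_trans[rotated])
  qed (simp add: fourier_spectrum_set_def sup0_def)
  show ?thesis
  proof (cases "ereal (real DIM('b)) \<le> ?L")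
    case False
    have "min (fourier_spectrum \<theta> \<mu>) (ereal (real DIM('a))) \<le> ?L + ereal c" if \<mu>: "\<mu> \<in> cs_measures X" for \<mu>
    proof -
      have "fourier_spectrum \<theta> (distr \<mu> borel (adjoint \<psi>)) \<le> ?L"
        using L[OF distr_adjoint_cs_measures[OF lin \<mu>]] False by (auto simp: min_le_iff_disj)
      moreover have "fourier_spectrum \<theta> \<mu> - ereal c \<le> fourier_spectrum \<theta> (distr \<mu> borel (adjoint \<psi>))"
        unfolding c_def using \<mu> by (intro fourier_spectrum_distr_adjoint lin iso \<theta> dim) (auto simp: cs_measures_iff)
      ultimately have "fourier_spectrum \<theta> \<mu> - ereal c \<le> ?L" by (rule order_trans[rotated])
      then have "fourier_spectrum \<theta> \<mu> \<le> ?L + ereal c" by (simp add: ereal_minus_le)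
      then show ?thesis by (simp add: min_le_iff_disj)
    qed
    \<comment> \<open>This serves the case where \<open>X\<close> carries no measure, when
      \<open>sup0\<close> is 0 and not minus infinity.\<close>
    moreover have "0 \<le> ?L + ereal c"
      using L0 c by (simp add: add_nonneg_nonneg)
    ultimately have "fourier_spectrum_set \<theta> X \<le> ?L + ereal c"
      unfolding fourier_spectrum_set_def[of \<theta> X] sup0_def by (auto intro!: Sup_least)
    then have "fourier_spectrum_set \<theta> X - ereal c \<le> ?L"
      by (simp add: ereal_minus_le)
    then show ?thesis
      unfolding c_def[symmetric] by (simp add: min_le_iff_disj)
  qed (simp add: min_le_iff_disj)
qed

theorem proposition4p2:
  fixes \<mu> :: "(real ^ 'd) measure"
    and X :: "(real ^ 'd) set"
    and V :: "(real ^ 'd) set"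
    and \<phi> :: "real ^ 'd \<Rightarrow> real ^ 'k"
    and \<theta> :: real
  assumes "CARD('k) < CARD('d)"
    and "\<mu> \<in> cs_measures UNIV"
    and "X \<in> sets borel"
    and "0 \<le> \<theta>" and "\<theta> \<le> 1"
    and "V \<in> grassmannian CARD('k)"
    and "identification V \<phi>"
  shows "fourier_spectrum \<theta> (proj_measure V \<phi> \<mu>)
           \<ge> fourier_spectrum \<theta> \<mu> - ereal ((real CARD('d) - real CARD('k)) * \<theta>)
       \<and> fourier_spectrum_set \<theta> (proj_set V \<phi> X)
           \<ge> min (ereal (real CARD('k)))
                 (fourier_spectrum_set \<theta> X - ereal ((real CARD('d) - real CARD('k)) * \<theta>))"
proof -
  have "subspace V" using assms(6) by (simp add: grassmannian_def)
  from identification_adjoint[OF this assms(7)]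
  obtain \<psi> :: "real ^ 'k \<Rightarrow> real ^ 'd" where lin: "linear \<psi>" and iso: "\<And>w. norm (\<psi> w) = norm w"
    and adj: "(\<lambda>x. \<phi> (orth_proj V x)) = adjoint \<psi>"
    by blast
  have DIM_eq: "DIM(real ^ 'k) = CARD('k)" "DIM(real ^ 'd) = CARD('d)" by simp_all
  have dim: "DIM(real ^ 'k) \<le> DIM(real ^ 'd)" using assms(1) by simp
  show ?thesis
    unfolding proj_measure_def proj_set_def adj
    using fourier_spectrum_distr_adjoint[OF assms(2) lin iso assms(4,5) dim, unfolded DIM_eq]
      fourier_spectrum_set_adjoint[OF lin iso assms(4,5) dim, of X, unfolded DIM_eq]
    by (rule conjI)
qed

end
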